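(* Let $\mathbf k$ be a field and let $K$ be a simplicial complex on the vertex set $[m]$, $K\ne 2^{[m]}$. Then the correspondence $v_Iu_J\mapsto (D_IT_J)^{*}$ (for $I\in K$, $J\subset[m]$, $I\cap J=\varnothing$) establishes an isomorphism of differential graded algebras $$\mathcal C^{*}(K)\;\cong\;\mathcal C^{*}(\mathcal Z_K).$$
   Context: $[m]=\{1,\ldots,m\}$; $K\subset 2^{[m]}$ is viewed as a set of subsets closed under passing to subsets, $\varnothing\in K$, and every $\{i\}$, $i\in[m]$, belongs to $K$. The algebra $\mathcal C^{*}(K)$. The face ring is $\mathbf k(K)=\mathbf k[v_1,\ldots,v_m]/\mathcal I$, where $\mathcal I$ is generated by the square-free monomials $v_{i_1}\cdots v_{i_s}$ with $\{i_1,\ldots,i_s\}\notin K$. Consider $\mathbf k(K)\otimes\Lambda[u_1,\ldots,u_m]$ with $\deg v_i=2$, $\deg u_i=1$ and the differential (derivation) $d$, $d(u_i)=v_i$, $d(v_i)=0$. For $I=\{i_1<\dots<i_p\}$, $J=\{j_1<\dots<j_q\}$ put $v_Iu_J=v_{i_1}\cdots v_{i_p}u_{j_1}\cdots u_{j_q}$. $\mathcal C^{*}(K)$ is the $\mathbf k$-subspace (a subcomplex with respect to $d$) spanned by the monomials $v_Iu_J$ with $I\in K$, $I\cap J=\varnothing$. Its multiplication is the one for which the projection $\mathbf k(K)\otimes\Lambda[u_1,\ldots,u_m]\to\mathcal C^{*}(K)$, sending each monomial $v_Iu_J$ with $I\in K$, $I\cap J=\varnothing$ to itself and all other monomials to $0$,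 is a homomorphism of algebras; i.e. $\mathcal C^{*}(K)=\mathbf k(K)\otimes\Lambda[u_1,\ldots,u_m]/(v_i^2,\,v_iu_i,\ i=1,\ldots,m)$. The algebra $\mathcal C^{*}(\mathcal Z_K)$. Let $(D^2)^m=\{z\in\mathbb C^m:|z_i|\le1\}$ and $$\mathcal Z_K=\bigcup_{J\in K}B_J,\qquad B_J=\{z\in(D^2)^m:\ |z_j|=1\text{ for }j\notin J\}.$$ Give $D^2$ the cell decomposition with one $0$-cell $1$ (the point $1\in S^1$), one $1$-cell $T=S^1\setminus\{1\}$, and one $2$-cell $D$ (the open disk), with $\partial_c D=T$, $\partial_c T=0$. The product decomposition of $(D^2)^m$ has $3^m$ cells $D_IT_P$ ($I,P\subset[m]$, $I\cap P=\varnothing$), where the $i$-th factor is $D$ for $i\in I$, $T$ for $i\in P$, and $1$ otherwise. $\mathcal Z_K$ is the cellular subcomplex consisting of all cells $D_IT_P$ with $I\in K$. $\mathcal C_{*}(\mathcal Z_K)$ denotes its cellular chain complex over $\mathbf k$ (product orientations, factors taken in increasing order of index, differential $\partial_c$ given by the Leibniz rule), and $\mathcal C^{*}(\mathcal Z_K)$ the dual cellular cochain complex with differential $d_c$, $(d_c a,b)=(a,\partial_c b)$, and basis $(D_IT_J)^{*}$ dual to the cells. Its multiplication: writing $D_i^*$, $T_i^*$ for the cochains dual to the cells $D_{\{i\}}T_\varnothing$ and $D_\varnothing T_{\{i\}}$, $\mathcal C^{*}(\mathcal Z_K)$ is the graded-commutative algebra multiplicatively generated by $T_i^{*}$ (degree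 1) and $D_i^{*}$ (degree 2), where $(D_IT_J)^{*}=\prod_{i\in I}D_i^{*}\prod_{j\in J}T_j^{*}$ (indices increasing) for $I\in K$, $I\cap J=\varnothing$, and where $(D_i^* )^2=0$, $(T_i^* )^2=0$, $D_i^{*}T_i^{*}=0$, and $\prod_{i\in I}D_i^{*}=0$ for $I\notin K$ (the structure induced from the $m$-fold tensor product of the cochain algebra of $D^2$ with basis $1^*,T^*,D^*$, $1^*$ the unit, all other products zero). *)

theory Defs
  imports "HOL-Algebra.Algebra" "HOL-Algebra.Algebraic_Closure_Type" "HOL-Library.Poly_Mapping"
begin

section \<open>Differential graded algebras over a commutative ring\<close>

record ('k, 'a) dga = "('k, 'a) module" +
  graded :: "nat \<Rightarrow> 'a set"
  diff :: "'a \<Rightarrow> 'a"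

text \<open>Cohomological convention: the differential raises the degree by one.\<close>

locale dg_algebra = module R A + ring A for R and A :: "('k, 'a) dga" (structure) +
  assumes smult_mult_left: "\<lbrakk>c \<in> carrier R; x \<in> carrier A; y \<in> carrier A\<rbrakk>
      \<Longrightarrow> (c \<odot> x) \<otimes> y = c \<odot> (x \<otimes> y)"
    and smult_mult_right: "\<lbrakk>c \<in> carrier R; x \<in> carrier A; y \<in> carrier A\<rbrakk>
      \<Longrightarrow> x \<otimes> (c \<odot> y) = c \<odot> (x \<otimes> y)"
    and graded_submodule: "submodule (graded A n) R A"
    and graded_direct_sum: "x \<in> carrier A \<Longrightarrow>
      \<exists>!f. (\<forall>n. f n \<in> graded A n) \<and> finite {n. f n \<noteq> \<zero>} \<and> x = finsum A f {n. f n \<noteq> \<zero>}"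
    and graded_one: "\<one> \<in> graded A 0"
    and graded_mult: "\<lbrakk>x \<in> graded A p; y \<in> graded A q\<rbrakk> \<Longrightarrow> x \<otimes> y \<in> graded A (p + q)"
    and diff_add: "\<lbrakk>x \<in> carrier A; y \<in> carrier A\<rbrakk> \<Longrightarrow> diff A (x \<oplus> y) = diff A x \<oplus> diff A y"
    and diff_smult: "\<lbrakk>c \<in> carrier R; x \<in> carrier A\<rbrakk> \<Longrightarrow> diff A (c \<odot> x) = c \<odot> diff A x"
    and diff_graded: "x \<in> graded A n \<Longrightarrow> diff A x \<in> graded A (Suc n)"
    and diff_diff: "x \<in> carrier A \<Longrightarrow> diff A (diff A x) = \<zero>"
    and diff_mult: "\<lbrakk>x \<in> graded A p; y \<in> carrier A\<rbrakk>
      \<Longrightarrow> diff A (x \<otimes> y) = (diff A x \<otimes> y) \<oplus> add_pow A ((-1::int) ^ p) (x \<otimes> diff A y)"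

definition dga_iso ::
    "('k, 'm) ring_scheme \<Rightarrow> ('k, 'a) dga \<Rightarrow> ('k, 'b) dga \<Rightarrow> ('a \<Rightarrow> 'b) set" where
  "dga_iso R A B = {\<phi> \<in> ring_iso A B.
      (\<forall>c\<in>carrier R. \<forall>x\<in>carrier A. \<phi> (c \<odot>\<^bsub>A\<^esub> x) = c \<odot>\<^bsub>B\<^esub> \<phi> x) \<and>
      (\<forall>n. \<phi> ` graded A n = graded B n) \<and>
      (\<forall>x\<in>carrier A. \<phi> (diff A x) = diff B (\<phi> x))}"

definition mod_span :: "('k, 'm) ring_scheme \<Rightarrow> ('k, 'a, 'n) module_scheme \<Rightarrow> 'a set \<Rightarrow> 'a set" where
  "mod_span R M S = \<Inter>{H. submodule H R M \<and> S \<subseteq> H}"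

abbreviation scalars :: "'k::field ring" where
  "scalars \<equiv> ring_of_type_algebra"


section \<open>Simplicial complexes and face rings\<close>

definition simplicial_complex_on :: "nat \<Rightarrow> nat set set \<Rightarrow> bool" where
  "simplicial_complex_on m K \<longleftrightarrow> K \<subseteq> Pow {1..m} \<and> {} \<in> K \<and>
     (\<forall>I\<in>K. \<forall>J\<subseteq>I. J \<in> K) \<and> (\<forall>i\<in>{1..m}. {i} \<in> K)"

text \<open>Polynomials are finitely supported functions from exponent vectors to coefficients, with the
  convolution product; \<^term>\<open>polys m\<close> is the ring of polynomials in the variables $v_1,\ldots,v_m$.\<close>

type_synonym 'k mpoly = "(nat \<Rightarrow>\<^sub>0 nat) \<Rightarrow>\<^sub>0 'k"

definition polys :: "nat \<Rightarrow> 'k::field mpoly ring" where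
  "polys m = \<lparr>carrier = {p. \<forall>\<alpha>\<in>Poly_Mapping.keys p. Poly_Mapping.keys \<alpha> \<subseteq> {1..m}},
     monoid.mult = (\<lambda>p q. p * q), one = 1, ring.zero = 0, add = (\<lambda>p q. p + q)\<rparr>"

definition vmono :: "(nat \<Rightarrow>\<^sub>0 nat) \<Rightarrow> 'k::field mpoly" where
  "vmono \<alpha> = Poly_Mapping.single \<alpha> 1"

definition sqfree :: "nat set \<Rightarrow> nat \<Rightarrow>\<^sub>0 nat" where
  "sqfree I = (\<Sum>i\<in>I. Poly_Mapping.single i 1)"

definition face_ideal :: "nat \<Rightarrow> nat set set \<Rightarrow> 'k::field mpoly set" where
  "face_ideal m K = Idl\<^bsub>polys m\<^esub> {vmono (sqfree I) | I. I \<subseteq> {1..m} \<and> I \<notin> K}"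

definition face_ring :: "nat \<Rightarrow> nat set set \<Rightarrow> 'k::field mpoly set ring" where
  "face_ring m K = polys m Quot face_ideal m K"

definition face_class :: "nat \<Rightarrow> nat set set \<Rightarrow> 'k::field mpoly \<Rightarrow> 'k mpoly set" where
  "face_class m K p = face_ideal m K +>\<^bsub>polys m\<^esub> p"


section \<open>The algebra $\mathbf k(K)\otimes\Lambda[u_1,\ldots,u_m]$\<close>

text \<open>This is the exterior algebra over the face ring, i.e. the free module over the face ring with
  basis $u_J$, $J\subseteq[m]$: an element $\sum_J a_J u_J$ is the function $J \mapsto a_J$.
  Since the $v_i$ have even degree,
  $(a\,u_J)(b\,u_{J'}) = \pm ab\,u_{J\cup J'}$ for disjoint $J, J'$, the sign being that of the
  permutation sorting the concatenation of $J$ and $J'$, and $0$ otherwise.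
  The derivation $d$ with $du_i=v_i$, $dv_i=0$ is
  $d(a\,u_J)=\sum_{j\in J}(-1)^{|\{i\in J:\,i<j\}|}\,v_j a\,u_{J\setminus\{j\}}$; below this is
  read off at the coefficient of $u_L$, where $J = L\cup\{j\}$.\<close>

definition inversions :: "nat set \<Rightarrow> nat set \<Rightarrow> nat" where
  "inversions J J' = card {(j, j'). j \<in> J \<and> j' \<in> J' \<and> j' < j}"

text \<open>An element \<open>kmono m K \<alpha> J\<close> is the monomial $v^\alpha u_J$; it vanishes when the
  support of $\alpha$ is not a simplex.\<close>

definition kmono :: "nat \<Rightarrow> nat set set \<Rightarrow> (nat \<Rightarrow>\<^sub>0 nat) \<Rightarrow> nat set \<Rightarrow> (nat set \<Rightarrow> 'k::field mpoly set)" where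
  "kmono m K \<alpha> J =
     (\<lambda>L\<in>Pow {1..m}. if L = J then face_class m K (vmono \<alpha>) else \<zero>\<^bsub>face_ring m K\<^esub>)"

definition koszul_module :: "nat \<Rightarrow> nat set set \<Rightarrow> ('k::field, nat set \<Rightarrow> 'k mpoly set) module" where
  "koszul_module m K = (let F = face_ring m K in
     \<lparr>carrier = Pow {1..m} \<rightarrow>\<^sub>E carrier F,
      monoid.mult = (\<lambda>x y. \<lambda>L\<in>Pow {1..m}.
         \<Oplus>\<^bsub>F\<^esub> J\<in>Pow L. add_pow F ((-1::int) ^ inversions J (L - J)) (x J \<otimes>\<^bsub>F\<^esub> y (L - J))),
      one = (\<lambda>L\<in>Pow {1..m}. if L = {} then \<one>\<^bsub>F\<^esub> else \<zero>\<^bsub>F\<^esub>),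
      ring.zero = (\<lambda>L\<in>Pow {1..m}. \<zero>\<^bsub>F\<^esub>),
      add = (\<lambda>x y. \<lambda>L\<in>Pow {1..m}. x L \<oplus>\<^bsub>F\<^esub> y L),
      module.smult = (\<lambda>c x. \<lambda>L\<in>Pow {1..m}. face_class m K (Poly_Mapping.single 0 c) \<otimes>\<^bsub>F\<^esub> x L)\<rparr>)"

definition koszul_graded :: "nat \<Rightarrow> nat set set \<Rightarrow> nat \<Rightarrow> (nat set \<Rightarrow> 'k::field mpoly set) set" where
  "koszul_graded m K n = mod_span scalars (koszul_module m K)
     {kmono m K \<alpha> J | \<alpha> J. Poly_Mapping.keys \<alpha> \<subseteq> {1..m} \<and> J \<subseteq> {1..m} \<and>
        2 * (\<Sum>i\<in>{1..m}. Poly_Mapping.lookup \<alpha> i) + card J = n}"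

definition koszul_diff ::
    "nat \<Rightarrow> nat set set \<Rightarrow> (nat set \<Rightarrow> 'k::field mpoly set) \<Rightarrow> nat set \<Rightarrow> 'k mpoly set" where
  "koszul_diff m K x = (let F = face_ring m K in
     (\<lambda>L\<in>Pow {1..m}. \<Oplus>\<^bsub>F\<^esub> j\<in>{1..m} - L.
       add_pow F ((-1::int) ^ card {i\<in>L. i < j})
         (face_class m K (vmono (Poly_Mapping.single j 1)) \<otimes>\<^bsub>F\<^esub> x (insert j L))))"


section \<open>The algebra $\mathcal C^*(K)$\<close>

definition vu :: "nat \<Rightarrow> nat set set \<Rightarrow> nat set \<Rightarrow> nat set \<Rightarrow> (nat set \<Rightarrow> 'k::field mpoly set)" where
  "vu m K I J = kmono m K (sqfree I) J"

definition CK_space :: "nat \<Rightarrow> nat set set \<Rightarrow> (nat set \<Rightarrow> 'k::field mpoly set) set" where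
  "CK_space m K = mod_span scalars (koszul_module m K)
     {vu m K I J | I J. I \<in> K \<and> J \<subseteq> {1..m} \<and> I \<inter> J = {}}"

text \<open>The span of all the other monomials $v^\alpha u_J$, and the linear projection onto
  \<^const>\<open>CK_space\<close> along it.\<close>

definition CK_kernel :: "nat \<Rightarrow> nat set set \<Rightarrow> (nat set \<Rightarrow> 'k::field mpoly set) set" where
  "CK_kernel m K = mod_span scalars (koszul_module m K)
     {kmono m K \<alpha> J | \<alpha> J. Poly_Mapping.keys \<alpha> \<subseteq> {1..m} \<and> J \<subseteq> {1..m} \<and>
        \<not> (\<exists>I\<in>K. I \<inter> J = {} \<and> \<alpha> = sqfree I)}"

definition CK_proj ::
    "nat \<Rightarrow> nat set set \<Rightarrow> (nat set \<Rightarrow> 'k::field mpoly set) \<Rightarrow> (nat set \<Rightarrow> 'k mpoly set)" where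
  "CK_proj m K w = (THE z. z \<in> CK_space m K \<and>
     (\<exists>r\<in>CK_kernel m K. w = z \<oplus>\<^bsub>koszul_module m K\<^esub> r))"

definition CK :: "nat \<Rightarrow> nat set set \<Rightarrow> ('k::field, nat set \<Rightarrow> 'k mpoly set) dga" where
  "CK m K = (let E = koszul_module m K in
     \<lparr>carrier = CK_space m K,
      monoid.mult = (\<lambda>x y. CK_proj m K (x \<otimes>\<^bsub>E\<^esub> y)),
      one = CK_proj m K \<one>\<^bsub>E\<^esub>,
      ring.zero = \<zero>\<^bsub>E\<^esub>,
      add = (\<lambda>x y. x \<oplus>\<^bsub>E\<^esub> y),
      module.smult = (\<lambda>c x. c \<odot>\<^bsub>E\<^esub> x),
      graded = (\<lambda>n. CK_space m K \<inter> koszul_graded m K n),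
      diff = koszul_diff m K\<rparr>)"


section \<open>The space $\mathcal Z_K$ and its cells\<close>

definition polydisc_part :: "nat \<Rightarrow> nat set \<Rightarrow> (nat \<Rightarrow> complex) set" where
  "polydisc_part m J = {z \<in> {1..m} \<rightarrow>\<^sub>E {w. cmod w \<le> 1}. \<forall>j\<in>{1..m} - J. cmod (z j) = 1}"

definition ZK :: "nat \<Rightarrow> nat set set \<Rightarrow> (nat \<Rightarrow> complex) set" where
  "ZK m K = (\<Union>J\<in>K. polydisc_part m J)"

text \<open>The three cells $1$, $T$, $D$ of the closed unit disc.\<close>

datatype disc_cell = CPt | CT | CD

fun cell_set :: "disc_cell \<Rightarrow> complex set" where
  "cell_set CPt = {1}"
| "cell_set CT = {w. cmod w = 1 \<and> w \<noteq> 1}"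
| "cell_set CD = {w. cmod w < 1}"

fun cell_dim :: "disc_cell \<Rightarrow> nat" where
  "cell_dim CPt = 0"
| "cell_dim CT = 1"
| "cell_dim CD = 2"

type_synonym pcell = "nat \<Rightarrow> disc_cell"

definition pcell_set :: "nat \<Rightarrow> pcell \<Rightarrow> (nat \<Rightarrow> complex) set" where
  "pcell_set m c = (\<Pi>\<^sub>E i\<in>{1..m}. cell_set (c i))"

definition pcell_dim :: "nat \<Rightarrow> pcell \<Rightarrow> nat" where
  "pcell_dim m c = (\<Sum>i\<in>{1..m}. cell_dim (c i))"

definition ZK_cells :: "nat \<Rightarrow> nat set set \<Rightarrow> pcell set" where
  "ZK_cells m K = {c \<in> {1..m} \<rightarrow>\<^sub>E UNIV. pcell_set m c \<subseteq> ZK m K}"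

text \<open>The product cell $D_I T_P$.\<close>

definition DT :: "nat \<Rightarrow> nat set \<Rightarrow> nat set \<Rightarrow> pcell" where
  "DT m I P = (\<lambda>i\<in>{1..m}. if i \<in> I then CD else if i \<in> P then CT else CPt)"

lemma DT_in_ZK_cells_iff:
  assumes "simplicial_complex_on m K" "I \<subseteq> {1..m}" "P \<subseteq> {1..m}" "I \<inter> P = {}"
  shows "DT m I P \<in> ZK_cells m K \<longleftrightarrow> I \<in> K"
proof
  assume "DT m I P \<in> ZK_cells m K"
  then have sub: "pcell_set m (DT m I P) \<subseteq> ZK m K"
    by (simp add: ZK_cells_def)
  define z :: "nat \<Rightarrow> complex" where
    "z = (\<lambda>i\<in>{1..m}. if i \<in> I then 0 else if i \<in> P then -1 else 1)"
  have "z \<in> pcell_set m (DT m I P)"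
    by (auto simp: pcell_set_def DT_def z_def PiE_iff)
  then obtain J where J: "J \<in> K" "z \<in> polydisc_part m J"
    using sub by (auto simp: ZK_def)
  have "I \<subseteq> J"
    using J(2) assms(2) by (force simp: polydisc_part_def z_def)
  then show "I \<in> K"
    using J(1) assms(1) by (auto simp: simplicial_complex_on_def)
next
  assume "I \<in> K"
  have "pcell_set m (DT m I P) \<subseteq> polydisc_part m I"
  proof
    fix z assume "z \<in> pcell_set m (DT m I P)"
    then have z: "z \<in> extensional {1..m}"
        "\<And>i. i \<in> {1..m} \<Longrightarrow> z i \<in> cell_set (if i \<in> I then CD else if i \<in> P then CT else CPt)"
      by (auto simp: pcell_set_def DT_def PiE_def Pi_def)
    have "cmod (z i) \<le> 1 \<and> (i \<notin> I \<longrightarrow> cmod (z i) = 1)" if "i \<in> {1..m}" for i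
      using z(2)[OF that] by (auto split: if_splits)
    then show "z \<in> polydisc_part m I"
      using z(1) by (auto simp: polydisc_part_def PiE_iff)
  qed
  moreover have "DT m I P \<in> {1..m} \<rightarrow>\<^sub>E UNIV"
    by (simp add: DT_def)
  ultimately show "DT m I P \<in> ZK_cells m K"
    using \<open>I \<in> K\<close> by (auto simp: ZK_cells_def ZK_def)
qed


section \<open>The algebra $\mathcal C^*(\mathcal Z_K)$\<close>

text \<open>Leibniz rule with $\partial D=T$, $\partial T=\partial 1=0$; the sign is $(-1)$ to the sum of
  the dimensions of the preceding factors.\<close>

definition pcell_boundary :: "nat \<Rightarrow> pcell \<Rightarrow> (pcell \<Rightarrow>\<^sub>0 'k::field)" where
  "pcell_boundary m c = (\<Sum>i\<in>{i\<in>{1..m}. c i = CD}.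
     Poly_Mapping.single (c(i := CT)) ((-1) ^ (\<Sum>j\<in>{1..<i}. cell_dim (c j))))"

definition pairing :: "(pcell \<Rightarrow> 'k::field) \<Rightarrow> (pcell \<Rightarrow>\<^sub>0 'k) \<Rightarrow> 'k" where
  "pairing a b = (\<Sum>c\<in>Poly_Mapping.keys b. a c * Poly_Mapping.lookup b c)"

text \<open>The product of basis cochains of the disc: $1^*$ is the unit, all other products vanish
  (\<^const>\<open>None\<close>).\<close>

fun cell_mult :: "disc_cell \<Rightarrow> disc_cell \<Rightarrow> disc_cell option" where
  "cell_mult CPt y = Some y"
| "cell_mult x CPt = Some x"
| "cell_mult _ _ = None"

text \<open>The product of basis cochains in the $m$-fold tensor product,
  $(x_1\otimes\cdots\otimes x_m)(y_1\otimes\cdots\otimes y_m) =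
   (-1)^{\sum_{j<i}|x_i||y_j|}\, x_1y_1\otimes\cdots\otimes x_my_m$:
  \<^term>\<open>pcell_mult_coeff m x y c\<close> is its coefficient at the basis cochain dual to the cell $c$.\<close>

definition pcell_mult_coeff :: "nat \<Rightarrow> pcell \<Rightarrow> pcell \<Rightarrow> pcell \<Rightarrow> 'k::field" where
  "pcell_mult_coeff m x y c =
     (if \<forall>i\<in>{1..m}. cell_mult (x i) (y i) = Some (c i)
      then (-1) ^ (\<Sum>i\<in>{1..m}. \<Sum>j\<in>{1..<i}. cell_dim (x i) * cell_dim (y j))
      else 0)"

definition cell_dual :: "nat \<Rightarrow> nat set set \<Rightarrow> pcell \<Rightarrow> (pcell \<Rightarrow> 'k::field)" where
  "cell_dual m K e = (\<lambda>c\<in>ZK_cells m K. if c = e then 1 else 0)"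

definition CZK :: "nat \<Rightarrow> nat set set \<Rightarrow> ('k::field, pcell \<Rightarrow> 'k) dga" where
  "CZK m K = (let C = ZK_cells m K in
     \<lparr>carrier = C \<rightarrow>\<^sub>E UNIV,
      monoid.mult = (\<lambda>a b. \<lambda>c\<in>C. \<Sum>x\<in>C. \<Sum>y\<in>C. pcell_mult_coeff m x y c * (a x * b y)),
      one = cell_dual m K (DT m {} {}),
      ring.zero = (\<lambda>c\<in>C. 0),
      add = (\<lambda>a b. \<lambda>c\<in>C. a c + b c),
      module.smult = (\<lambda>k a. \<lambda>c\<in>C. k * a c),
      graded = (\<lambda>n. {a \<in> C \<rightarrow>\<^sub>E UNIV. \<forall>c\<in>C. a c \<noteq> 0 \<longrightarrow> pcell_dim m c = n}),
      diff = (\<lambda>a. \<lambda>c\<in>C. pairing a (pcell_boundary m c))\<rparr>)"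

end

theory Submission
  imports Defs
begin

text \<open>
  Both algebras are finite dimensional with bases indexed by the same pairs \<open>(I, J)\<close>, where
  \<open>I \<in> K\<close>, \<open>J \<subseteq> {1..m}\<close> and \<open>I \<inter> J = {}\<close>: the monomials $v_Iu_J$ on one side, the cochains
  $(D_IT_J)^*$ on the other. The theorem holds because in these bases the two products, units,
  differentials and gradings have the same structure constants:
  $$ e_{A,B}\,e_{A',B'} = \pm\, e_{A\cup A',\,B\cup B'}, \qquad
     d\,e_{I,J} = \sum_{j\in J} \pm\, e_{I\cup\{j\},\,J\setminus\{j\}}, $$
  where the product is $0$ unless $A, A', B, B'$ are pairwise disjoint, and terms that leave the
  index set are dropped.
  The sign of the product counts the pairs in $B \times B'$ that are out of order, and that of the
  differential the elements of $J$ before $j$. On the algebraic side these come from sorting the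
  $u_j$; on the topological side from the Koszul sign rule, to which only the cells $T$ contribute
  since $D$ and $1$ have even dimension.

  Accordingly the structure constants are studied once, detached from either algebra. Reading off
  coordinates turns an element into a function of \<open>(I, J)\<close>; the transported operations are
  \<open>monomial_mult\<close> and \<open>monomial_diff\<close>. Associativity (\<open>monomial_mult_assoc\<close>) amounts to the
  bilinearity of the inversion number, \<open>d \<circ> d = 0\<close> (\<open>monomial_diff_diff\<close>) to the
  antisymmetry of the sign in two exchanged vertices, and the Leibniz rule
  (\<open>monomial_diff_mult\<close>) to splitting the sum according to the factor that the exchanged vertex
  comes from. The locale \<open>dga_coordinates\<close> says that an algebra has coordinates in which its
  operations take this form. Such an algebra is a differential graded algebra
  (\<open>dg_algebra\<close> in that locale), and two of them are isomorphic by matching coordinates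
  (\<open>dga_iso_of_coordinates\<close>).

  It remains to find coordinates. For cochains they are the values on the cells \<open>DT m I J\<close>.
  For $\mathcal C^*(K)$ the coordinate at \<open>(I, J)\<close> is the coefficient of $v_I$ in the component
  at $u_J$. This makes sense because the face ideal consists of exactly the polynomials without
  monomials supported on a simplex (\<open>face_ideal_eq\<close>), so that coefficients at such monomials are
  well defined on the face ring and determine its elements. Every span of monomials is then
  the set of elements whose coefficients vanish off a set of exponents (\<open>mod_span_kmono\<close>), which
  describes $\mathcal C^*(K)$, the kernel of the projection and the grading uniformly, and shows
  that the projection changes no coordinate (\<open>CK_coord_proj\<close>).
\<close>

section \<open>Signs of shuffles\<close>

lemma inversions_Un_left:
  assumes "finite A" "finite B" "finite C" "A \<inter> B = {}"
  shows "inversions (A \<union> B) C = inversions A C + inversions B C"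
proof -
  have "{(j, j'). j \<in> A \<union> B \<and> j' \<in> C \<and> j' < j} =
      {(j, j'). j \<in> A \<and> j' \<in> C \<and> j' < j} \<union> {(j, j'). j \<in> B \<and> j' \<in> C \<and> j' < j}"
    by auto
  moreover have "finite {(j, j'). j \<in> D \<and> j' \<in> C \<and> j' < j}" if "finite D" for D
    by (rule finite_subset[of _ "Sigma D (\<lambda>_. C)"]) (use that assms in auto)
  ultimately show ?thesis
    unfolding inversions_def using assms by (simp, subst card_Un_disjoint) auto
qed

lemma inversions_Un_right:
  assumes "finite A" "finite B" "finite C" "A \<inter> B = {}"
  shows "inversions C (A \<union> B) = inversions C A + inversions C B"
proof -
  have "{(j, j'). j \<in> C \<and> j' \<in> A \<union> B \<and> j' < j} =
      {(j, j'). j \<in> C \<and> j' \<in> A \<and> j' < j} \<union> {(j, j'). j \<in> C \<and> j' \<in> B \<and> j' < j}"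
    by auto
  moreover have "finite {(j, j'). j \<in> C \<and> j' \<in> D \<and> j' < j}" if "finite D" for D
    by (rule finite_subset[of _ "Sigma C (\<lambda>_. D)"]) (use that assms in auto)
  ultimately show ?thesis
    unfolding inversions_def using assms by (simp, subst card_Un_disjoint) auto
qed

lemma inversions_empty [simp]: "inversions {} J = 0" "inversions J {} = 0"
  by (simp_all add: inversions_def)

lemma inversions_singleton_left: "inversions {i} J = card {j \<in> J. j < i}"
proof -
  have "{(j, j'). j \<in> {i} \<and> j' \<in> J \<and> j' < j} = Pair i ` {j \<in> J. j < i}"
    by auto
  then show ?thesis
    by (simp add: inversions_def card_image inj_on_def)
qed

lemma inversions_singleton_right: "inversions J {i} = card {j \<in> J. i < j}"
proof -
  have "{(j, j'). j \<in> J \<and> j' \<in> {i} \<and> j' < j} = (\<lambda>j. (j, i)) ` {j \<in> J. i < j}"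
    by auto
  then show ?thesis
    by (simp add: inversions_def card_image inj_on_def)
qed

text \<open>Each element of \<open>J\<close> forms an inversion with \<open>i\<close> in exactly one of the two orders. This is the
  source of the sign \<open>(-1) ^ p\<close> in the Leibniz rule.\<close>
lemma inversions_swap_singleton:
  assumes "finite J" "i \<notin> J"
  shows "inversions {i} J + inversions J {i} = card J"
proof -
  have "finite {j \<in> J. j < i}" "finite {j \<in> J. i < j}"
    using assms(1) by simp_all
  moreover have "{j \<in> J. j < i} \<inter> {j \<in> J. i < j} = {}"
    by auto
  moreover have "{j \<in> J. j < i} \<union> {j \<in> J. i < j} = J"
    using assms(2) by (auto, metis linorder_neqE_nat)
  ultimately have "card J = card {j \<in> J. j < i} + card {j \<in> J. i < j}"
    by (metis card_Un_disjoint)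
  then show ?thesis
    by (simp add: inversions_singleton_left inversions_singleton_right)
qed


section \<open>The structure constants\<close>

text \<open>The product of two functions on index pairs. If \<open>e A B\<close> denotes the basis element dual to
  the coordinate \<open>(A, B)\<close>, this is the bilinear product with
  \<open>e A B * e A' B' = (-1) ^ inversions B B' * e (A \<union> A') (B \<union> B')\<close> for \<open>A \<inter> A' = B \<inter> B' = {}\<close>
  and \<open>0\<close> otherwise. The simplicial complex does not appear: subsets of a simplex are simplices,
  so that the value at an admissible pair only involves admissible pairs.\<close>
definition monomial_mult :: "(nat set \<Rightarrow> nat set \<Rightarrow> 'k::comm_ring_1) \<Rightarrow> (nat set \<Rightarrow> nat set \<Rightarrow> 'k)
    \<Rightarrow> nat set \<Rightarrow> nat set \<Rightarrow> 'k" where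
  "monomial_mult a b I J = (\<Sum>A\<in>Pow I. \<Sum>B\<in>Pow J.
     (-1) ^ inversions B (J - B) * (a A B * b (I - A) (J - B)))"

text \<open>The basis elements whose differential involves \<open>e I J\<close> are obtained by moving some \<open>i \<in> I\<close>
  to the second set; this again stays within the admissible pairs.\<close>
definition monomial_diff :: "(nat set \<Rightarrow> nat set \<Rightarrow> 'k::comm_ring_1) \<Rightarrow> nat set \<Rightarrow> nat set \<Rightarrow> 'k" where
  "monomial_diff a I J = (\<Sum>i\<in>I. (-1) ^ card {j \<in> J. j < i} * a (I - {i}) (insert i J))"

definition monomial_one :: "nat set \<Rightarrow> nat set \<Rightarrow> 'k::comm_ring_1" where
  "monomial_one I J = (if I = {} \<and> J = {} then 1 else 0)"

text \<open>Both sides run over the ordered partitions of \<open>I\<close> into three parts.\<close>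
lemma sum_Pow_split:
  fixes f :: "'a set \<Rightarrow> 'a set \<Rightarrow> 'a set \<Rightarrow> 'b::comm_monoid_add"
  assumes "finite I"
  shows "(\<Sum>A\<in>Pow I. \<Sum>A1\<in>Pow A. f A1 (A - A1) (I - A)) =
    (\<Sum>A1\<in>Pow I. \<Sum>A2\<in>Pow (I - A1). f A1 A2 (I - A1 - A2))"
proof -
  have fin: "\<forall>A\<in>Pow I. finite (Pow A)" "\<forall>A\<in>Pow I. finite (Pow (I - A))" "finite (Pow I)"
    using assms by (auto intro: finite_subset)
  have "(\<Sum>(A, A1)\<in>(SIGMA A:Pow I. Pow A). f A1 (A - A1) (I - A)) =
      (\<Sum>(A1, A2)\<in>(SIGMA A:Pow I. Pow (I - A)). f A1 A2 (I - A1 - A2))"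
    by (rule sum.reindex_bij_witness[where i = "\<lambda>(A1, A2). (A1 \<union> A2, A1)"
          and j = "\<lambda>(A, A1). (A1, A - A1)"])
      (auto intro!: arg_cong[of _ _ "f _ _"])
  then show ?thesis
    using fin by (simp add: sum.Sigma)
qed

text \<open>After reindexing by ordered partitions of \<open>I\<close> and of \<open>J\<close> into three parts, both sides carry
  the sign that counts the inversions between any two of the parts of \<open>J\<close>.\<close>
lemma monomial_mult_assoc:
  assumes "finite I" "finite J"
  shows "monomial_mult (monomial_mult a b) c I J = monomial_mult a (monomial_mult b c) I J"
proof -
  define g where "g a1 a2 a3 b1 b2 b3 =
     (-1) ^ (inversions b1 b2 + inversions b1 b3 + inversions b2 b3) *
     (a a1 b1 * b a2 b2 * c a3 b3)" for a1 a2 a3 b1 b2 b3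
  have "monomial_mult (monomial_mult a b) c I J =
      (\<Sum>A\<in>Pow I. \<Sum>B\<in>Pow J. \<Sum>A1\<in>Pow A. \<Sum>B1\<in>Pow B. g A1 (A - A1) (I - A) B1 (B - B1) (J - B))"
    unfolding monomial_mult_def sum_distrib_left sum_distrib_right
  proof (intro sum.cong refl)
    fix A B A1 B1 assume *: "A \<in> Pow I" "B \<in> Pow J" "A1 \<in> Pow A" "B1 \<in> Pow B"
    have fin: "finite B1" "finite (B - B1)" "finite (J - B)"
      using * assms by (auto dest: finite_subset)
    have "inversions B (J - B) = inversions B1 (J - B) + inversions (B - B1) (J - B)"
      using inversions_Un_left[of B1 "B - B1" "J - B"] fin * by (simp add: Un_absorb1)
    then show "(-1) ^ inversions B (J - B) * ((-1) ^ inversions B1 (B - B1) *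
        (a A1 B1 * b (A - A1) (B - B1)) * c (I - A) (J - B)) =
        g A1 (A - A1) (I - A) B1 (B - B1) (J - B)"
      by (simp add: g_def power_add algebra_simps)
  qed
  also have "\<dots> = (\<Sum>A\<in>Pow I. \<Sum>A1\<in>Pow A. \<Sum>B\<in>Pow J. \<Sum>B1\<in>Pow B.
      g A1 (A - A1) (I - A) B1 (B - B1) (J - B))"
    by (intro sum.cong refl sum.swap)
  also have "\<dots> = (\<Sum>A\<in>Pow I. \<Sum>A1\<in>Pow A. \<Sum>B1\<in>Pow J. \<Sum>B2\<in>Pow (J - B1).
      g A1 (A - A1) (I - A) B1 B2 (J - B1 - B2))"
    using assms(2) by (intro sum.cong refl sum_Pow_split)
  also have "\<dots> = (\<Sum>A1\<in>Pow I. \<Sum>A2\<in>Pow (I - A1). \<Sum>B1\<in>Pow J. \<Sum>B2\<in>Pow (J - B1).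
      g A1 A2 (I - A1 - A2) B1 B2 (J - B1 - B2))"
    by (rule sum_Pow_split[OF assms(1), of
        "\<lambda>a1 a2 a3. \<Sum>B1\<in>Pow J. \<Sum>B2\<in>Pow (J - B1). g a1 a2 a3 B1 B2 (J - B1 - B2)"])
  also have "\<dots> = (\<Sum>A1\<in>Pow I. \<Sum>B1\<in>Pow J. \<Sum>A2\<in>Pow (I - A1). \<Sum>B2\<in>Pow (J - B1).
      g A1 A2 (I - A1 - A2) B1 B2 (J - B1 - B2))"
    by (intro sum.cong refl sum.swap)
  also have "\<dots> = monomial_mult a (monomial_mult b c) I J"
    unfolding monomial_mult_def sum_distrib_left sum_distrib_right
  proof (intro sum.cong refl)
    fix A1 B1 A2 B2
    assume *: "A1 \<in> Pow I" "B1 \<in> Pow J" "A2 \<in> Pow (I - A1)" "B2 \<in> Pow (J - B1)"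
    have fin: "finite B1" "finite B2" "finite (J - B1 - B2)"
      using * assms by (auto dest: finite_subset)
    have "B2 \<union> (J - B1 - B2) = J - B1"
      using * by auto
    then have "inversions B1 (J - B1) = inversions B1 B2 + inversions B1 (J - B1 - B2)"
      using inversions_Un_right[of B2 "J - B1 - B2" B1] fin by auto
    then show "g A1 A2 (I - A1 - A2) B1 B2 (J - B1 - B2) =
      (-1) ^ inversions B1 (J - B1) * (a A1 B1 * ((-1) ^ inversions B2 (J - B1 - B2) *
        (b A2 B2 * c (I - A1 - A2) (J - B1 - B2))))"
      by (simp add: g_def power_add algebra_simps)
  qed
  finally show ?thesis .
qed

lemma monomial_mult_one_left:
  assumes "finite I" "finite J"
  shows "monomial_mult monomial_one a I J = a I J"
proof -
  have "monomial_mult monomial_one a I J = (\<Sum>A\<in>Pow I. if A = {} then (\<Sum>B\<in>Pow J. if B = {} then a I J else 0) else 0)"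
    unfolding monomial_mult_def by (intro sum.cong refl) (auto simp: monomial_one_def intro!: sum.cong)
  then show ?thesis
    using assms by simp
qed

lemma monomial_mult_one_right:
  assumes "finite I" "finite J"
  shows "monomial_mult a monomial_one I J = a I J"
proof -
  have "monomial_mult a monomial_one I J = (\<Sum>A\<in>Pow I. if A = I then (\<Sum>B\<in>Pow J. if B = J then a I J else 0) else 0)"
    unfolding monomial_mult_def
    by (intro sum.cong refl) (auto simp: monomial_one_def intro!: sum.cong)
  then show ?thesis
    using assms by simp
qed

text \<open>The terms of the double sum cancel in pairs: for \<open>i < k\<close>, moving \<open>i\<close> first raises the number
  of elements before \<open>k\<close> by one, moving \<open>k\<close> first does not affect the count at \<open>i\<close>. Pairing the
  terms, rather than arguing that the sum equals its own negative, also covers characteristic two.\<close>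
lemma monomial_diff_diff:
  assumes "finite I" "finite J" "I \<inter> J = {}"
  shows "monomial_diff (monomial_diff a) I J = 0"
proof -
  define f where "f i k = (-1) ^ card {j \<in> J. j < i} * ((-1) ^ card {j \<in> insert i J. j < k} *
      a (I - {i} - {k}) (insert k (insert i J)))" for i k
  have anti: "f i k = - f k i" if "i \<in> I" "k \<in> I" "i < k" for i k
  proof -
    have "{j \<in> insert i J. j < k} = insert i {j \<in> J. j < k}" "{j \<in> insert k J. j < i} = {j \<in> J. j < i}"
      using that by auto
    moreover have "i \<notin> J" using that assms by auto
    moreover have "a (I - {k} - {i}) (insert i (insert k J)) = a (I - {i} - {k}) (insert k (insert i J))"
      by (intro arg_cong2[of _ _ _ _ a]) auto
    ultimately show ?thesis
      using assms by (simp add: f_def algebra_simps)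
  qed
  have "monomial_diff (monomial_diff a) I J = (\<Sum>i\<in>I. \<Sum>k\<in>I - {i}. f i k)"
    by (simp add: monomial_diff_def f_def sum_distrib_left)
  also have "\<dots> = (\<Sum>i\<in>I. (\<Sum>k\<in>{k \<in> I. i < k}. f i k) + (\<Sum>k\<in>{k \<in> I. k < i}. f i k))"
  proof (intro sum.cong refl)
    fix i assume "i \<in> I"
    have eq: "{k \<in> I. i < k} \<union> {k \<in> I. k < i} = I - {i}" by auto
    have "finite {k \<in> I. i < k}" "finite {k \<in> I. k < i}" using assms(1) by simp_all
    moreover have "{k \<in> I. i < k} \<inter> {k \<in> I. k < i} = {}" by auto
    ultimately have "sum (f i) ({k \<in> I. i < k} \<union> {k \<in> I. k < i}) =
        (\<Sum>k\<in>{k \<in> I. i < k}. f i k) + (\<Sum>k\<in>{k \<in> I. k < i}. f i k)"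
      by (rule sum.union_disjoint)
    then show "(\<Sum>k\<in>I - {i}. f i k) = (\<Sum>k\<in>{k \<in> I. i < k}. f i k) + (\<Sum>k\<in>{k \<in> I. k < i}. f i k)"
      unfolding eq .
  qed
  also have "\<dots> = (\<Sum>i\<in>I. \<Sum>k\<in>{k \<in> I. i < k}. f i k) + (\<Sum>i\<in>I. \<Sum>k\<in>{k \<in> I. k < i}. f i k)"
    by (rule sum.distrib)
  also have "(\<Sum>i\<in>I. \<Sum>k\<in>{k \<in> I. k < i}. f i k) = (\<Sum>k\<in>I. \<Sum>i\<in>{i \<in> I. k < i}. f i k)"
    using assms by (intro sum.swap_restrict)
  also have "\<dots> = (\<Sum>k\<in>I. \<Sum>i\<in>{i \<in> I. k < i}. - f k i)"
  proof (intro sum.cong refl)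
    fix k i assume "k \<in> I" "i \<in> {i \<in> I. k < i}"
    then have "f k i = - f i k" by (intro anti) auto
    then show "f i k = - f k i" by simp
  qed
  finally show ?thesis
    by (simp add: sum_negf)
qed

text \<open>In the Leibniz rule, the two sums separate the terms in which the new index lies in the left
  factor from those in which it lies in the right factor.\<close>
lemma sum_Pow_insert:
  fixes f :: "'a set \<Rightarrow> 'b::comm_monoid_add"
  assumes "finite J" "i \<notin> J"
  shows "(\<Sum>B\<in>Pow (insert i J). f B) = (\<Sum>B\<in>Pow J. f (insert i B)) + (\<Sum>B\<in>Pow J. f B)"
proof -
  have "inj_on (insert i) (Pow J)"
    using assms(2) by (auto simp: inj_on_def insert_ident)
  moreover have "Pow J \<inter> insert i ` Pow J = {}"
    using assms(2) by auto
  ultimately show ?thesis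
    using assms by (simp add: Pow_insert sum.union_disjoint sum.reindex add.commute)
qed

text \<open>In the coordinate of \<open>d(ab)\<close> at \<open>(I, J)\<close>, each \<open>i \<in> I\<close> is moved to \<open>J\<close>, and the enlarged set
  \<open>J \<union> {i}\<close> is distributed over the two factors. The terms with \<open>i\<close> on the left make up
  \<open>(da)b\<close>. In those with \<open>i\<close> on the right, \<open>i\<close> also has to pass the set \<open>B\<close> belonging to \<open>a\<close>, which
  costs \<open>(-1) ^ card B = (-1) ^ p\<close>.\<close>
lemma monomial_diff_mult:
  assumes "finite I" "finite J" "I \<inter> J = {}"
    and deg: "\<And>A B. A \<subseteq> I \<Longrightarrow> B \<subseteq> J \<Longrightarrow> a A B \<noteq> 0 \<Longrightarrow> 2 * card A + card B = p"
  shows "monomial_diff (monomial_mult a b) I J = monomial_mult (monomial_diff a) b I J + (-1) ^ p * monomial_mult a (monomial_diff b) I J"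
proof -
  let ?s = "\<lambda>i J. (-1) ^ card {j \<in> J. j < i} :: 'a"
  have left: "(\<Sum>i\<in>I. \<Sum>A\<in>Pow (I - {i}). \<Sum>B\<in>Pow J. ?s i J * ((-1) ^ inversions (insert i B) (J - B) *
        (a A (insert i B) * b (I - {i} - A) (J - B)))) = monomial_mult (monomial_diff a) b I J"
  proof -
    have "(\<Sum>i\<in>I. \<Sum>A\<in>Pow (I - {i}). \<Sum>B\<in>Pow J. ?s i J * ((-1) ^ inversions (insert i B) (J - B) *
        (a A (insert i B) * b (I - {i} - A) (J - B)))) =
      (\<Sum>i\<in>I. \<Sum>A\<in>{A \<in> Pow I. i \<in> A}. \<Sum>B\<in>Pow J. ?s i J * ((-1) ^ inversions (insert i B) (J - B) *
        (a (A - {i}) (insert i B) * b (I - A) (J - B))))"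
    proof (rule sum.cong[OF refl], rule sum.reindex_bij_witness[where i = "\<lambda>A. A - {i}" and j = "insert i" for i])
      fix i A assume *: "i \<in> I" "A \<in> Pow (I - {i})"
      then have "insert i A - {i} = A" "I - insert i A = I - {i} - A" by auto
      then show "(\<Sum>B\<in>Pow J. ?s i J * ((-1) ^ inversions (insert i B) (J - B) *
          (a (insert i A - {i}) (insert i B) * b (I - insert i A) (J - B)))) =
        (\<Sum>B\<in>Pow J. ?s i J * ((-1) ^ inversions (insert i B) (J - B) *
          (a A (insert i B) * b (I - {i} - A) (J - B))))" by simp
    qed auto
    also have "\<dots> = (\<Sum>A\<in>Pow I. \<Sum>i\<in>{i \<in> I. i \<in> A}. \<Sum>B\<in>Pow J. ?s i J *
        ((-1) ^ inversions (insert i B) (J - B) * (a (A - {i}) (insert i B) * b (I - A) (J - B))))"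
      using assms by (intro sum.swap_restrict) auto
    also have "\<dots> = (\<Sum>A\<in>Pow I. \<Sum>B\<in>Pow J. \<Sum>i\<in>{i \<in> I. i \<in> A}. ?s i J *
        ((-1) ^ inversions (insert i B) (J - B) * (a (A - {i}) (insert i B) * b (I - A) (J - B))))"
      by (intro sum.cong refl sum.swap)
    also have "\<dots> = monomial_mult (monomial_diff a) b I J"
      unfolding monomial_mult_def monomial_diff_def sum_distrib_left sum_distrib_right
    proof (intro sum.cong refl)
      fix A B i assume *: "A \<in> Pow I" "B \<in> Pow J" "i \<in> A"
      have fin: "finite B" "finite (J - B)" and "i \<notin> J"
        using * assms by (auto dest: finite_subset)
      have "inversions (insert i B) (J - B) = card {j \<in> J - B. j < i} + inversions B (J - B)"
        using inversions_Un_left[of "{i}" B "J - B"] fin * \<open>i \<notin> J\<close>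
        by (auto simp: inversions_singleton_left)
      moreover have "card {j \<in> J. j < i} = card {j \<in> B. j < i} + card {j \<in> J - B. j < i}"
        using fin * by (subst card_Un_disjoint[symmetric]) (auto intro!: arg_cong[of _ _ card])
      ultimately have "?s i J * (-1) ^ inversions (insert i B) (J - B) = (-1) ^ inversions B (J - B) * ?s i B"
        by (simp add: power_add algebra_simps flip: power_mult_distrib)
      then show "?s i J * ((-1) ^ inversions (insert i B) (J - B) * (a (A - {i}) (insert i B) * b (I - A) (J - B))) =
          (-1) ^ inversions B (J - B) * (?s i B * a (A - {i}) (insert i B) * b (I - A) (J - B))"
        by (simp add: mult.assoc[symmetric])
    qed auto
    finally show ?thesis .
  qed
  have right: "(\<Sum>i\<in>I. \<Sum>A\<in>Pow (I - {i}). \<Sum>B\<in>Pow J. ?s i J * ((-1) ^ inversions B (insert i J - B) *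
        (a A B * b (I - {i} - A) (insert i J - B)))) = (-1) ^ p * monomial_mult a (monomial_diff b) I J"
  proof -
    have "(\<Sum>i\<in>I. \<Sum>A\<in>Pow (I - {i}). \<Sum>B\<in>Pow J. ?s i J * ((-1) ^ inversions B (insert i J - B) *
        (a A B * b (I - {i} - A) (insert i J - B)))) =
      (\<Sum>i\<in>I. \<Sum>A\<in>{A \<in> Pow I. i \<notin> A}. \<Sum>B\<in>Pow J. ?s i J * ((-1) ^ inversions B (insert i J - B) *
        (a A B * b (I - {i} - A) (insert i J - B))))"
      by (intro sum.cong refl) auto
    also have "\<dots> = (\<Sum>A\<in>Pow I. \<Sum>i\<in>{i \<in> I. i \<notin> A}. \<Sum>B\<in>Pow J. ?s i J *
        ((-1) ^ inversions B (insert i J - B) * (a A B * b (I - {i} - A) (insert i J - B))))"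
      using assms by (intro sum.swap_restrict) auto
    also have "\<dots> = (\<Sum>A\<in>Pow I. \<Sum>B\<in>Pow J. \<Sum>i\<in>{i \<in> I. i \<notin> A}. ?s i J *
        ((-1) ^ inversions B (insert i J - B) * (a A B * b (I - {i} - A) (insert i J - B))))"
      by (intro sum.cong refl sum.swap)
    also have "\<dots> = (-1) ^ p * monomial_mult a (monomial_diff b) I J"
      unfolding monomial_mult_def monomial_diff_def sum_distrib_left sum_distrib_right
    proof (intro sum.cong refl)
      fix A B i assume *: "A \<in> Pow I" "B \<in> Pow J" "i \<in> I - A"
      have fin: "finite B" "finite (J - B)" and "i \<notin> J" "i \<notin> B"
        using * assms by (auto dest: finite_subset)
      have eqs: "insert i J - B = insert i (J - B)" "I - {i} - A = I - A - {i}"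
        using \<open>i \<notin> B\<close> by auto
      show "?s i J * ((-1) ^ inversions B (insert i J - B) * (a A B * b (I - {i} - A) (insert i J - B))) =
          (-1) ^ p * ((-1) ^ inversions B (J - B) * (a A B * (?s i (J - B) * b (I - A - {i}) (insert i (J - B)))))"
      proof (cases "a A B = 0")
        case False
        have "inversions B (insert i (J - B)) = inversions B {i} + inversions B (J - B)"
          using inversions_Un_right[of "{i}" "J - B" B] fin * \<open>i \<notin> J\<close> by auto
        moreover have "card {j \<in> J. j < i} = inversions {i} B + card {j \<in> J - B. j < i}"
          unfolding inversions_singleton_left
          using fin * by (subst card_Un_disjoint[symmetric]) (auto intro!: arg_cong[of _ _ card])
        moreover have "(-1) ^ p = ((-1) ^ (inversions {i} B + inversions B {i}) :: 'a)"
          using deg[OF _ _ False] * inversions_swap_singleton[OF fin(1) \<open>i \<notin> B\<close>]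
          by (auto simp: power_add power_mult)
        ultimately have "?s i J * (-1) ^ inversions B (insert i (J - B)) =
            (-1) ^ p * (-1) ^ inversions B (J - B) * ?s i (J - B)"
          by (simp add: power_add algebra_simps)
        then show ?thesis
          unfolding eqs by (simp add: algebra_simps) (simp add: mult.assoc[symmetric])
      qed simp
    qed auto
    finally show ?thesis .
  qed
  have "monomial_diff (monomial_mult a b) I J = (\<Sum>i\<in>I. ?s i J * (\<Sum>A\<in>Pow (I - {i}).
      (\<Sum>B\<in>Pow J. (-1) ^ inversions (insert i B) (J - B) * (a A (insert i B) * b (I - {i} - A) (J - B))) +
      (\<Sum>B\<in>Pow J. (-1) ^ inversions B (insert i J - B) * (a A B * b (I - {i} - A) (insert i J - B)))))"
    unfolding monomial_diff_def monomial_mult_def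
  proof (intro sum.cong refl arg_cong[of _ _ "(*) _"])
    fix i A assume "i \<in> I" "A \<in> Pow (I - {i})"
    then have "i \<notin> J" using assms by auto
    then have eq: "insert i J - insert i B = J - B" for B by auto
    show "(\<Sum>B\<in>Pow (insert i J). (-1) ^ inversions B (insert i J - B) * (a A B * b (I - {i} - A) (insert i J - B))) =
      (\<Sum>B\<in>Pow J. (-1) ^ inversions (insert i B) (J - B) * (a A (insert i B) * b (I - {i} - A) (J - B))) +
      (\<Sum>B\<in>Pow J. (-1) ^ inversions B (insert i J - B) * (a A B * b (I - {i} - A) (insert i J - B)))"
      by (subst sum_Pow_insert[OF assms(2) \<open>i \<notin> J\<close>]) (simp add: eq)
  qed
  also have "\<dots> = monomial_mult (monomial_diff a) b I J + (-1) ^ p * monomial_mult a (monomial_diff b) I J"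
    unfolding left[symmetric] right[symmetric]
    by (simp add: sum.distrib sum_distrib_left distrib_left)
  finally show ?thesis .
qed

lemma monomial_mult_cong:
  assumes "\<And>A B. A \<subseteq> I \<Longrightarrow> B \<subseteq> J \<Longrightarrow> a A B = a' A B" "\<And>A B. A \<subseteq> I \<Longrightarrow> B \<subseteq> J \<Longrightarrow> b A B = b' A B"
  shows "monomial_mult a b I J = monomial_mult a' b' I J"
  unfolding monomial_mult_def using assms by (intro sum.cong refl arg_cong2[of _ _ _ _ "(*)"]) auto

lemma monomial_diff_cong:
  assumes "\<And>i. i \<in> I \<Longrightarrow> a (I - {i}) (insert i J) = b (I - {i}) (insert i J)"
  shows "monomial_diff a I J = monomial_diff b I J"
  unfolding monomial_diff_def using assms by (intro sum.cong refl arg_cong2[of _ _ _ _ "(*)"]) auto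


section \<open>Differential graded algebras with prescribed structure constants\<close>

definition basis_index :: "nat \<Rightarrow> nat set set \<Rightarrow> nat set \<Rightarrow> nat set \<Rightarrow> bool" where
  "basis_index m K I J \<longleftrightarrow> I \<in> K \<and> J \<subseteq> {1..m} \<and> I \<inter> J = {}"

lemma basis_index_subset:
  assumes "simplicial_complex_on m K" "basis_index m K I J" "A \<subseteq> I" "B \<subseteq> J"
  shows "basis_index m K A B"
proof -
  have "I \<in> K" "J \<subseteq> {1..m}" "I \<inter> J = {}"
    using assms(2) by (simp_all add: basis_index_def)
  moreover have "A \<in> K"
    using assms(1,3) \<open>I \<in> K\<close> unfolding simplicial_complex_on_def by simp
  ultimately show ?thesis
    using assms(3,4) unfolding basis_index_def by auto
qed

text \<open>In \<open>monomial_diff\<close> the arguments \<open>(I - {i}, J \<union> {i})\<close> are admissible since \<open>i\<close> has left \<open>I\<close>.\<close>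
lemma basis_index_exchange:
  assumes "simplicial_complex_on m K" "basis_index m K I J" "i \<in> I"
  shows "basis_index m K (I - {i}) (insert i J)"
proof -
  have "I \<in> K" "J \<subseteq> {1..m}" "I \<inter> J = {}"
    using assms(2) by (simp_all add: basis_index_def)
  moreover have "I - {i} \<in> K" "I \<subseteq> {1..m}"
    using assms(1) \<open>I \<in> K\<close> unfolding simplicial_complex_on_def by auto
  ultimately show ?thesis
    using assms(3) unfolding basis_index_def by auto
qed

lemma basis_index_vertices:
  assumes "simplicial_complex_on m K" "basis_index m K I J"
  shows "I \<subseteq> {1..m}" "J \<subseteq> {1..m}"
  using assms unfolding basis_index_def simplicial_complex_on_def by auto

lemma basis_index_finite:
  assumes "simplicial_complex_on m K" "basis_index m K I J"
  shows "finite I" "finite J"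
  using basis_index_vertices[OF assms] by (auto intro: finite_subset)

lemma (in abelian_group) add_pow_sign:
  assumes "x \<in> carrier G"
  shows "add_pow G ((-1::int) ^ p) x = (if even p then x else \<ominus> x)"
  using assms by (simp add: add_pow_int_ge add_pow_int_lt)

lemma monomial_diff_add: "monomial_diff (\<lambda>I J. a I J + b I J) I J = monomial_diff a I J + monomial_diff b I J"
  by (simp add: monomial_diff_def distrib_left sum.distrib)

lemma monomial_diff_scale: "monomial_diff (\<lambda>I J. c * a I J) I J = c * monomial_diff a I J"
  by (simp add: monomial_diff_def sum_distrib_left mult.left_commute)

lemma monomial_mult_add_left: "monomial_mult (\<lambda>I J. a I J + b I J) c I J = monomial_mult a c I J + monomial_mult b c I J"
  by (simp add: monomial_mult_def distrib_left distrib_right sum.distrib)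

lemma monomial_mult_add_right: "monomial_mult c (\<lambda>I J. a I J + b I J) I J = monomial_mult c a I J + monomial_mult c b I J"
  by (simp add: monomial_mult_def distrib_left distrib_right sum.distrib)

lemma monomial_mult_scale_left: "monomial_mult (\<lambda>I J. c * a I J) b I J = c * monomial_mult a b I J"
  by (simp add: monomial_mult_def sum_distrib_left mult.left_commute mult.assoc)

lemma monomial_mult_scale_right: "monomial_mult a (\<lambda>I J. c * b I J) I J = c * monomial_mult a b I J"
  by (simp add: monomial_mult_def sum_distrib_left mult.left_commute mult.assoc)

text \<open>The coordinate map identifies the carrier with the functions on admissible pairs; only its
  values at admissible pairs matter, so \<open>coord x\<close> is an arbitrary total function otherwise.
  Under this identification the operations are those of the structure constants above, and the
  basis element at \<open>(I, J)\<close> has degree \<open>2 * card I + card J\<close>.\<close>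
locale dga_coordinates =
  fixes m :: nat and K :: "nat set set" and A :: "('k::field, 'a) dga" (structure)
    and coord :: "'a \<Rightarrow> nat set \<Rightarrow> nat set \<Rightarrow> 'k"
  assumes complex: "simplicial_complex_on m K"
    and coord_eqI: "\<lbrakk>x \<in> carrier A; y \<in> carrier A;
      \<And>I J. basis_index m K I J \<Longrightarrow> coord x I J = coord y I J\<rbrakk> \<Longrightarrow> x = y"
    and coord_surj: "\<exists>x\<in>carrier A. \<forall>I J. basis_index m K I J \<longrightarrow> coord x I J = f I J"
    and zero_in: "\<zero> \<in> carrier A"
    and one_in: "\<one> \<in> carrier A"
    and add_in: "\<lbrakk>x \<in> carrier A; y \<in> carrier A\<rbrakk> \<Longrightarrow> x \<oplus> y \<in> carrier A"
    and mult_in: "\<lbrakk>x \<in> carrier A; y \<in> carrier A\<rbrakk> \<Longrightarrow> x \<otimes> y \<in> carrier A"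
    and smult_in: "x \<in> carrier A \<Longrightarrow> c \<odot> x \<in> carrier A"
    and diff_in: "x \<in> carrier A \<Longrightarrow> diff A x \<in> carrier A"
    and coord_zero: "basis_index m K I J \<Longrightarrow> coord \<zero> I J = 0"
    and coord_one: "basis_index m K I J \<Longrightarrow> coord \<one> I J = monomial_one I J"
    and coord_add: "\<lbrakk>basis_index m K I J; x \<in> carrier A; y \<in> carrier A\<rbrakk>
      \<Longrightarrow> coord (x \<oplus> y) I J = coord x I J + coord y I J"
    and coord_mult: "\<lbrakk>basis_index m K I J; x \<in> carrier A; y \<in> carrier A\<rbrakk>
      \<Longrightarrow> coord (x \<otimes> y) I J = monomial_mult (coord x) (coord y) I J"
    and coord_smult: "\<lbrakk>basis_index m K I J; x \<in> carrier A\<rbrakk> \<Longrightarrow> coord (c \<odot> x) I J = c * coord x I J"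
    and coord_diff: "\<lbrakk>basis_index m K I J; x \<in> carrier A\<rbrakk> \<Longrightarrow> coord (diff A x) I J = monomial_diff (coord x) I J"
    and graded_eq: "graded A n =
      {x \<in> carrier A. \<forall>I J. basis_index m K I J \<and> coord x I J \<noteq> 0 \<longrightarrow> 2 * card I + card J = n}"
begin

lemmas closed_in = zero_in one_in add_in mult_in smult_in diff_in

lemmas index_finite = basis_index_finite[OF complex]

lemma coord_mult_left:
  assumes "basis_index m K I J" "x \<in> carrier A" "y \<in> carrier A" "z \<in> carrier A"
  shows "coord ((x \<otimes> y) \<otimes> z) I J = monomial_mult (monomial_mult (coord x) (coord y)) (coord z) I J"
  unfolding coord_mult[OF assms(1) mult_in[OF assms(2,3)] assms(4)]
  using assms by (intro monomial_mult_cong coord_mult basis_index_subset[OF complex assms(1)] refl)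

lemma coord_mult_right:
  assumes "basis_index m K I J" "x \<in> carrier A" "y \<in> carrier A" "z \<in> carrier A"
  shows "coord (x \<otimes> (y \<otimes> z)) I J = monomial_mult (coord x) (monomial_mult (coord y) (coord z)) I J"
  unfolding coord_mult[OF assms(1,2) mult_in[OF assms(3,4)]]
  using assms by (intro monomial_mult_cong coord_mult basis_index_subset[OF complex assms(1)] refl)

lemma abelian_group: "abelian_group A"
proof (rule abelian_groupI)
  fix x assume x: "x \<in> carrier A"
  obtain y where "y \<in> carrier A" "\<forall>I J. basis_index m K I J \<longrightarrow> coord y I J = - coord x I J"
    using coord_surj[of "\<lambda>I J. - coord x I J"] by blast
  then show "\<exists>y\<in>carrier A. y \<oplus> x = \<zero>"
    using x by (intro bexI[of _ y] coord_eqI) (auto simp: closed_in coord_add coord_zero)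
qed (auto intro!: coord_eqI simp: closed_in coord_add coord_zero)

lemma ring: "ring A"
proof (rule ringI[OF abelian_group])
  show "monoid A"
  proof (rule monoidI)
    fix x y z assume *: "x \<in> carrier A" "y \<in> carrier A" "z \<in> carrier A"
    then show "(x \<otimes> y) \<otimes> z = x \<otimes> (y \<otimes> z)"
      by (intro coord_eqI closed_in)
        (simp_all only: coord_mult_left coord_mult_right monomial_mult_assoc index_finite)
  next
    fix x assume x: "x \<in> carrier A"
    then show "\<one> \<otimes> x = x"
    proof (intro coord_eqI closed_in)
      fix I J assume IJ: "basis_index m K I J"
      have "coord (\<one> \<otimes> x) I J = monomial_mult monomial_one (coord x) I J"
        unfolding coord_mult[OF IJ one_in x]
        by (intro monomial_mult_cong coord_one basis_index_subset[OF complex IJ] refl)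
      then show "coord (\<one> \<otimes> x) I J = coord x I J"
        by (simp add: monomial_mult_one_left index_finite[OF IJ])
    qed
    show "x \<otimes> \<one> = x"
    proof (intro coord_eqI closed_in x)
      fix I J assume IJ: "basis_index m K I J"
      have "coord (x \<otimes> \<one>) I J = monomial_mult (coord x) monomial_one I J"
        unfolding coord_mult[OF IJ x one_in]
        by (intro monomial_mult_cong coord_one basis_index_subset[OF complex IJ] refl)
      then show "coord (x \<otimes> \<one>) I J = coord x I J"
        by (simp add: monomial_mult_one_right index_finite[OF IJ])
    qed
  qed (auto intro: closed_in)
next
  fix x y z assume *: "x \<in> carrier A" "y \<in> carrier A" "z \<in> carrier A"
  show "(x \<oplus> y) \<otimes> z = x \<otimes> z \<oplus> y \<otimes> z"
  proof (intro coord_eqI closed_in *)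
    fix I J assume IJ: "basis_index m K I J"
    have "coord ((x \<oplus> y) \<otimes> z) I J = monomial_mult (\<lambda>I J. coord x I J + coord y I J) (coord z) I J"
      unfolding coord_mult[OF IJ add_in[OF *(1,2)] *(3)]
      using * by (intro monomial_mult_cong coord_add basis_index_subset[OF complex IJ] refl)
    then show "coord ((x \<oplus> y) \<otimes> z) I J = coord (x \<otimes> z \<oplus> y \<otimes> z) I J"
      using IJ * by (simp add: monomial_mult_add_left coord_add coord_mult closed_in)
  qed
  show "z \<otimes> (x \<oplus> y) = z \<otimes> x \<oplus> z \<otimes> y"
  proof (intro coord_eqI closed_in *)
    fix I J assume IJ: "basis_index m K I J"
    have "coord (z \<otimes> (x \<oplus> y)) I J = monomial_mult (coord z) (\<lambda>I J. coord x I J + coord y I J) I J"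
      unfolding coord_mult[OF IJ *(3) add_in[OF *(1,2)]]
      using * by (intro monomial_mult_cong coord_add basis_index_subset[OF complex IJ] refl)
    then show "coord (z \<otimes> (x \<oplus> y)) I J = coord (z \<otimes> x \<oplus> z \<otimes> y) I J"
      using IJ * by (simp add: monomial_mult_add_right coord_add coord_mult closed_in)
  qed
qed

lemma module: "module scalars A"
proof (rule moduleI[OF cring_from_type_algebra abelian_group])
qed (auto intro!: coord_eqI simp: closed_in coord_add coord_smult algebra_simps ring_of_type_algebra_def)

lemma coord_minus:
  assumes "basis_index m K I J" "x \<in> carrier A"
  shows "coord (\<ominus> x) I J = - coord x I J"
proof -
  interpret abelian_group A by (rule abelian_group)
  have "coord (\<ominus> x \<oplus> x) I J = 0"
    using assms by (simp add: l_neg coord_zero)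
  then show ?thesis
    using assms by (simp add: coord_add eq_neg_iff_add_eq_0)
qed

lemma coord_finsum:
  assumes "finite S" "f \<in> S \<rightarrow> carrier A" "basis_index m K I J"
  shows "coord (finsum A f S) I J = (\<Sum>s\<in>S. coord (f s) I J)"
proof -
  interpret abelian_group A by (rule abelian_group)
  show ?thesis
    using assms
  proof (induction S rule: finite_induct)
    case (insert s S)
    then have "finsum A f (insert s S) = f s \<oplus> finsum A f S"
      by (intro finsum_insert) auto
    moreover have "f s \<in> carrier A" "f \<in> S \<rightarrow> carrier A"
      using insert.prems by auto
    ultimately show ?case
      using insert by (simp add: coord_add)
  qed (simp add: coord_zero)
qed

text \<open>The component of degree \<open>n\<close> is obtained by keeping the coordinates at pairs of degree \<open>n\<close>.
  It vanishes for \<open>n > 3 * m\<close>, since both sets of a pair have at most \<open>m\<close> elements.\<close>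
lemma graded_decomposition:
  assumes x: "x \<in> carrier A"
  shows "\<exists>!f. (\<forall>n. f n \<in> graded A n) \<and> finite {n. f n \<noteq> \<zero>} \<and> x = finsum A f {n. f n \<noteq> \<zero>}"
proof -
  have coord_homogeneous_sum: "coord (finsum A f {n. f n \<noteq> \<zero>}) I J = coord (f (2 * card I + card J)) I J"
    if f: "\<And>n. f n \<in> graded A n" "finite {n. f n \<noteq> \<zero>}" and IJ: "basis_index m K I J" for f I J
  proof -
    let ?d = "2 * card I + card J"
    have "coord (f n) I J = (if n = ?d then coord (f ?d) I J else 0)" for n
      using f(1)[of n] IJ by (auto simp: graded_eq)
    then have "(\<Sum>n\<in>{n. f n \<noteq> \<zero>}. coord (f n) I J) =
        (\<Sum>n\<in>{n. f n \<noteq> \<zero>}. if n = ?d then coord (f ?d) I J else 0)"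
      by (intro sum.cong refl)
    also have "\<dots> = coord (f ?d) I J"
      using f(2) coord_zero[OF IJ] by (simp add: sum.delta)
    finally show ?thesis
      using f IJ by (subst coord_finsum) (auto simp: graded_eq)
  qed
  have "\<exists>y\<in>carrier A. \<forall>I J. basis_index m K I J \<longrightarrow>
      coord y I J = (if 2 * card I + card J = n then coord x I J else 0)" for n
    by (rule coord_surj)
  then obtain h where h: "\<And>n. h n \<in> carrier A"
      "\<And>n I J. basis_index m K I J \<Longrightarrow>
        coord (h n) I J = (if 2 * card I + card J = n then coord x I J else 0)"
    by metis
  have h_graded: "h n \<in> graded A n" for n
    using h by (auto simp: graded_eq split: if_splits)
  have "h n = \<zero>" if "n > 3 * m" for n
  proof (rule coord_eqI[OF h(1) zero_in])
    fix I J assume IJ: "basis_index m K I J"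
    have "card I \<le> m" "card J \<le> m"
      using basis_index_vertices[OF complex IJ] by (auto dest: card_mono[rotated])
    then show "coord (h n) I J = coord \<zero> I J"
      using IJ that by (simp add: h(2) coord_zero)
  qed
  then have "{n. h n \<noteq> \<zero>} \<subseteq> {..3 * m}"
    by (auto simp: not_less[symmetric])
  then have h_fin: "finite {n. h n \<noteq> \<zero>}"
    using finite_subset by blast
  have fs: "finsum A f S \<in> carrier A" if "f \<in> S \<rightarrow> carrier A" for f :: "nat \<Rightarrow> 'a" and S
  proof -
    interpret abelian_group A by (rule abelian_group)
    show ?thesis using that by (rule finsum_closed)
  qed
  show ?thesis
  proof (rule ex1I[of _ h], intro conjI allI)
    show "x = finsum A h {n. h n \<noteq> \<zero>}"
      using x h by (intro coord_eqI) (auto simp: coord_homogeneous_sum[OF h_graded h_fin] intro!: fs)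
  next
    fix f assume f: "(\<forall>n. f n \<in> graded A n) \<and> finite {n. f n \<noteq> \<zero>} \<and> x = finsum A f {n. f n \<noteq> \<zero>}"
    show "f = h"
    proof (rule ext, rule coord_eqI)
      fix n show "f n \<in> carrier A" "h n \<in> carrier A" using f h by (auto simp: graded_eq)
      fix I J assume IJ: "basis_index m K I J"
      show "coord (f n) I J = coord (h n) I J"
      proof (cases "n = 2 * card I + card J")
        case True
        then show ?thesis using f IJ h coord_homogeneous_sum[of f I J] by auto
      next
        case False
        have "f n \<in> graded A n" using f by blast
        then have "coord (f n) I J = 0" using IJ False unfolding graded_eq by blast
        then show ?thesis using False IJ by (simp add: h(2))
      qed
    qed
  qed (use h_graded h_fin in auto)
qed

lemma graded_mult:
  assumes x: "x \<in> graded A p" and y: "y \<in> graded A q"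
  shows "x \<otimes> y \<in> graded A (p + q)"
proof -
  have xy: "x \<in> carrier A" "y \<in> carrier A" using x y by (auto simp: graded_eq)
  have "2 * card I + card J = p + q" if IJ: "basis_index m K I J" and nz: "coord (x \<otimes> y) I J \<noteq> 0" for I J
  proof -
    obtain C D where CD: "C \<subseteq> I" "D \<subseteq> J" "coord x C D \<noteq> 0" "coord y (I - C) (J - D) \<noteq> 0"
      using nz unfolding coord_mult[OF IJ xy] monomial_mult_def by (force elim!: sum.not_neutral_contains_not_neutral)
    moreover have "basis_index m K C D" "basis_index m K (I - C) (J - D)"
      using CD IJ by (auto intro!: basis_index_subset[OF complex IJ])
    ultimately have "2 * card C + card D = p" "2 * card (I - C) + card (J - D) = q"
      using x y by (auto simp: graded_eq)
    moreover have "card I = card C + card (I - C)" "card J = card D + card (J - D)"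
      using CD index_finite[OF IJ] by (simp_all add: card_Diff_subset finite_subset card_mono)
    ultimately show ?thesis by simp
  qed
  then show ?thesis
    using xy by (auto simp: graded_eq closed_in)
qed

lemma graded_diff:
  assumes x: "x \<in> graded A n"
  shows "diff A x \<in> graded A (Suc n)"
proof -
  have xc: "x \<in> carrier A" using x by (auto simp: graded_eq)
  have "2 * card I + card J = Suc n" if IJ: "basis_index m K I J" and nz: "coord (diff A x) I J \<noteq> 0" for I J
  proof -
    obtain i where i: "i \<in> I" "coord x (I - {i}) (insert i J) \<noteq> 0"
      using nz unfolding coord_diff[OF IJ xc] monomial_diff_def by (force elim!: sum.not_neutral_contains_not_neutral)
    then have "2 * card (I - {i}) + card (insert i J) = n"
      using x basis_index_exchange[OF complex IJ i(1)] unfolding graded_eq by blast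
    moreover have "card I = Suc (card (I - {i}))"
      using card_Suc_Diff1[OF index_finite(1)[OF IJ] i(1)] by (rule sym)
    moreover have "card (insert i J) = Suc (card J)"
    proof (rule card_insert_disjoint)
      show "i \<notin> J" using i(1) IJ by (auto simp: basis_index_def)
    qed (use index_finite[OF IJ] in simp)
    ultimately show ?thesis by simp
  qed
  then show ?thesis
    using xc by (auto simp: graded_eq closed_in)
qed

lemma leibniz:
  assumes x: "x \<in> graded A p" and y: "y \<in> carrier A"
  shows "diff A (x \<otimes> y) = (diff A x \<otimes> y) \<oplus> add_pow A ((-1::int) ^ p) (x \<otimes> diff A y)"
proof -
  interpret abelian_group A by (rule abelian_group)
  have xc: "x \<in> carrier A" using x by (auto simp: graded_eq)
  have "x \<otimes> diff A y \<in> carrier A" using xc y by (simp add: closed_in)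
  then have pow: "add_pow A ((-1::int) ^ p) (x \<otimes> diff A y) \<in> carrier A"
    and coord_pow: "\<And>I J. basis_index m K I J \<Longrightarrow>
      coord (add_pow A ((-1::int) ^ p) (x \<otimes> diff A y)) I J = (-1) ^ p * coord (x \<otimes> diff A y) I J"
    by (auto simp: add_pow_sign coord_minus)
  show ?thesis
  proof (intro coord_eqI closed_in xc y pow)
    fix I J assume IJ: "basis_index m K I J"
    have "coord (diff A (x \<otimes> y)) I J = monomial_diff (monomial_mult (coord x) (coord y)) I J"
      unfolding coord_diff[OF IJ mult_in[OF xc y]]
      using xc y by (intro monomial_diff_cong coord_mult basis_index_exchange[OF complex IJ])
    also have "\<dots> = monomial_mult (monomial_diff (coord x)) (coord y) I J + (-1) ^ p * monomial_mult (coord x) (monomial_diff (coord y)) I J"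
    proof (rule monomial_diff_mult)
      fix C D assume "C \<subseteq> I" "D \<subseteq> J" "coord x C D \<noteq> 0"
      then show "2 * card C + card D = p"
        using x basis_index_subset[OF complex IJ] by (auto simp: graded_eq)
    qed (use IJ index_finite[OF IJ] in \<open>auto simp: basis_index_def\<close>)
    also have "monomial_mult (monomial_diff (coord x)) (coord y) I J = coord (diff A x \<otimes> y) I J"
      unfolding coord_mult[OF IJ diff_in[OF xc] y]
      using xc by (intro monomial_mult_cong coord_diff[symmetric] basis_index_subset[OF complex IJ] refl)
    also have "monomial_mult (coord x) (monomial_diff (coord y)) I J = coord (x \<otimes> diff A y) I J"
      unfolding coord_mult[OF IJ xc diff_in[OF y]]
      using y by (intro monomial_mult_cong coord_diff[symmetric] basis_index_subset[OF complex IJ] refl)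
    finally show "coord (diff A (x \<otimes> y)) I J =
        coord ((diff A x \<otimes> y) \<oplus> add_pow A ((-1::int) ^ p) (x \<otimes> diff A y)) I J"
      using IJ xc y pow by (simp add: coord_add coord_pow closed_in)
  qed
qed

text \<open>Every axiom is an identity between elements, and hence between coordinates, where it becomes
  one of the identities for the structure constants. The congruence rules are needed because the
  coordinates of an intermediate result are known only at admissible pairs.\<close>
theorem dg_algebra: "dg_algebra scalars A"
proof (intro dg_algebra.intro dg_algebra_axioms.intro module ring graded_decomposition graded_mult graded_diff leibniz)
  interpret module scalars A by (rule module)
  show "submodule (graded A n) scalars A" for n
  proof (rule submoduleI)
    fix a b assume "a \<in> graded A n" "b \<in> graded A n"
    then have ab: "a \<in> carrier A" "b \<in> carrier A"
        "\<And>I J. basis_index m K I J \<Longrightarrow> coord a I J \<noteq> 0 \<or> coord b I J \<noteq> 0 \<Longrightarrow> 2 * card I + card J = n"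
      by (auto simp: graded_eq)
    have "2 * card I + card J = n" if IJ: "basis_index m K I J" and nz: "coord (a \<oplus> b) I J \<noteq> 0" for I J
    proof -
      have "coord a I J \<noteq> 0 \<or> coord b I J \<noteq> 0"
        using nz unfolding coord_add[OF IJ ab(1,2)] by auto
      then show ?thesis by (rule ab(3)[OF IJ])
    qed
    then show "a \<oplus> b \<in> graded A n"
      using ab(1,2) by (simp add: graded_eq closed_in)
  qed (auto simp: graded_eq closed_in coord_zero coord_minus coord_smult)
  fix x y c assume x: "x \<in> carrier A" and y: "y \<in> carrier A"
  show "(c \<odot> x) \<otimes> y = c \<odot> (x \<otimes> y)"
  proof (intro coord_eqI closed_in x y)
    fix I J assume IJ: "basis_index m K I J"
    have "coord ((c \<odot> x) \<otimes> y) I J = monomial_mult (\<lambda>I J. c * coord x I J) (coord y) I J"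
      unfolding coord_mult[OF IJ smult_in[OF x] y]
      using x by (intro monomial_mult_cong coord_smult basis_index_subset[OF complex IJ] refl)
    then show "coord ((c \<odot> x) \<otimes> y) I J = coord (c \<odot> (x \<otimes> y)) I J"
      using IJ x y by (simp add: monomial_mult_scale_left coord_smult coord_mult closed_in)
  qed
  show "x \<otimes> (c \<odot> y) = c \<odot> (x \<otimes> y)"
  proof (intro coord_eqI closed_in x y)
    fix I J assume IJ: "basis_index m K I J"
    have "coord (x \<otimes> (c \<odot> y)) I J = monomial_mult (coord x) (\<lambda>I J. c * coord y I J) I J"
      unfolding coord_mult[OF IJ x smult_in[OF y]]
      using y by (intro monomial_mult_cong coord_smult basis_index_subset[OF complex IJ] refl)
    then show "coord (x \<otimes> (c \<odot> y)) I J = coord (c \<odot> (x \<otimes> y)) I J"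
      using IJ x y by (simp add: monomial_mult_scale_right coord_smult coord_mult closed_in)
  qed
  show "diff A (x \<oplus> y) = diff A x \<oplus> diff A y"
  proof (intro coord_eqI closed_in x y)
    fix I J assume IJ: "basis_index m K I J"
    have "coord (diff A (x \<oplus> y)) I J = monomial_diff (\<lambda>I J. coord x I J + coord y I J) I J"
      unfolding coord_diff[OF IJ add_in[OF x y]]
      using x y by (intro monomial_diff_cong coord_add basis_index_exchange[OF complex IJ])
    then show "coord (diff A (x \<oplus> y)) I J = coord (diff A x \<oplus> diff A y) I J"
      using IJ x y by (simp add: monomial_diff_add coord_add coord_diff closed_in)
  qed
  show "diff A (c \<odot> x) = c \<odot> diff A x"
  proof (intro coord_eqI closed_in x)
    fix I J assume IJ: "basis_index m K I J"
    have "coord (diff A (c \<odot> x)) I J = monomial_diff (\<lambda>I J. c * coord x I J) I J"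
      unfolding coord_diff[OF IJ smult_in[OF x]]
      using x by (intro monomial_diff_cong coord_smult basis_index_exchange[OF complex IJ])
    then show "coord (diff A (c \<odot> x)) I J = coord (c \<odot> diff A x) I J"
      using IJ x by (simp add: monomial_diff_scale coord_smult coord_diff closed_in)
  qed
  show "diff A (diff A x) = \<zero>"
  proof (intro coord_eqI closed_in x)
    fix I J assume IJ: "basis_index m K I J"
    have "coord (diff A (diff A x)) I J = monomial_diff (monomial_diff (coord x)) I J"
      unfolding coord_diff[OF IJ diff_in[OF x]]
      using x by (intro monomial_diff_cong coord_diff basis_index_exchange[OF complex IJ])
    then show "coord (diff A (diff A x)) I J = coord \<zero> I J"
      using IJ index_finite[OF IJ] by (simp add: coord_zero monomial_diff_diff basis_index_def)
  qed
next
  show "\<one> \<in> graded A 0"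
    by (auto simp: graded_eq closed_in coord_one monomial_one_def split: if_splits)
qed

end

text \<open>The isomorphism takes an element to the one with the same coordinates.\<close>
theorem dga_iso_of_coordinates:
  assumes A: "dga_coordinates m K A \<kappa>" and B: "dga_coordinates m K B \<mu>"
  obtains \<phi> where "\<phi> \<in> dga_iso scalars A B"
    and "\<And>x I J. x \<in> carrier A \<Longrightarrow> basis_index m K I J \<Longrightarrow> \<mu> (\<phi> x) I J = \<kappa> x I J"
proof -
  interpret A: dga_coordinates m K A \<kappa> by (rule A)
  interpret B: dga_coordinates m K B \<mu> by (rule B)
  have "\<exists>y\<in>carrier B. \<forall>I J. basis_index m K I J \<longrightarrow> \<mu> y I J = \<kappa> x I J" for x
    by (rule B.coord_surj)
  then obtain \<phi> where \<phi>: "\<And>x. \<phi> x \<in> carrier B"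
      "\<And>x I J. basis_index m K I J \<Longrightarrow> \<mu> (\<phi> x) I J = \<kappa> x I J"
    by metis
  have hom: "\<phi> \<in> ring_hom A B"
  proof (rule ring_hom_memI)
    fix x y assume x: "x \<in> carrier A" and y: "y \<in> carrier A"
    show "\<phi> (x \<otimes>\<^bsub>A\<^esub> y) = \<phi> x \<otimes>\<^bsub>B\<^esub> \<phi> y"
    proof (intro B.coord_eqI \<phi> B.mult_in)
      fix I J assume IJ: "basis_index m K I J"
      have "monomial_mult (\<kappa> x) (\<kappa> y) I J = monomial_mult (\<mu> (\<phi> x)) (\<mu> (\<phi> y)) I J"
        by (intro monomial_mult_cong \<phi>(2)[symmetric] basis_index_subset[OF A.complex IJ])
      then show "\<mu> (\<phi> (x \<otimes>\<^bsub>A\<^esub> y)) I J = \<mu> (\<phi> x \<otimes>\<^bsub>B\<^esub> \<phi> y) I J"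
        using IJ x y \<phi> by (simp add: A.coord_mult B.coord_mult)
    qed
    show "\<phi> (x \<oplus>\<^bsub>A\<^esub> y) = \<phi> x \<oplus>\<^bsub>B\<^esub> \<phi> y"
      using x y \<phi> by (intro B.coord_eqI) (auto simp: B.add_in A.coord_add B.coord_add)
  next
    show "\<phi> \<one>\<^bsub>A\<^esub> = \<one>\<^bsub>B\<^esub>"
      using \<phi> by (intro B.coord_eqI) (auto simp: A.coord_one B.coord_one B.one_in)
  qed (use \<phi> in auto)
  have inj: "inj_on \<phi> (carrier A)"
    by (rule inj_onI) (metis A.coord_eqI \<phi>(2))
  have preimage: "\<exists>x\<in>carrier A. \<phi> x = y \<and> (\<forall>I J. basis_index m K I J \<longrightarrow> \<kappa> x I J = \<mu> y I J)"
    if y: "y \<in> carrier B" for y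
  proof -
    obtain x where x: "x \<in> carrier A" "\<forall>I J. basis_index m K I J \<longrightarrow> \<kappa> x I J = \<mu> y I J"
      using A.coord_surj[of "\<mu> y"] by blast
    then have "\<phi> x = y"
      using y \<phi> by (intro B.coord_eqI) auto
    with x show ?thesis by blast
  qed
  have "\<phi> ` carrier A = carrier B"
    using \<phi>(1) preimage by blast
  then have "\<phi> \<in> ring_iso A B"
    using hom inj by (simp add: ring_iso_def bij_betw_def)
  moreover have "\<phi> (c \<odot>\<^bsub>A\<^esub> x) = c \<odot>\<^bsub>B\<^esub> \<phi> x" if "x \<in> carrier A" for c x
    using that \<phi> by (intro B.coord_eqI) (auto simp: B.smult_in A.coord_smult B.coord_smult)
  moreover have "\<phi> ` graded A n = graded B n" for n
  proof
    show "\<phi> ` graded A n \<subseteq> graded B n"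
      using \<phi> by (auto simp: A.graded_eq B.graded_eq)
    show "graded B n \<subseteq> \<phi> ` graded A n"
    proof
      fix y assume y: "y \<in> graded B n"
      then obtain x where "x \<in> carrier A" "\<phi> x = y" "\<forall>I J. basis_index m K I J \<longrightarrow> \<kappa> x I J = \<mu> y I J"
        using preimage[of y] unfolding B.graded_eq by blast
      with y show "y \<in> \<phi> ` graded A n"
        by (intro image_eqI[of _ _ x]) (auto simp: A.graded_eq B.graded_eq)
    qed
  qed
  moreover have "\<phi> (diff A x) = diff B (\<phi> x)" if x: "x \<in> carrier A" for x
  proof (intro B.coord_eqI \<phi> B.diff_in)
    fix I J assume IJ: "basis_index m K I J"
    have "monomial_diff (\<kappa> x) I J = monomial_diff (\<mu> (\<phi> x)) I J"
      by (intro monomial_diff_cong \<phi>(2)[symmetric] basis_index_exchange[OF A.complex IJ])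
    then show "\<mu> (\<phi> (diff A x)) I J = \<mu> (diff B (\<phi> x)) I J"
      using IJ x \<phi> by (simp add: A.coord_diff B.coord_diff)
  qed
  ultimately have "\<phi> \<in> dga_iso scalars A B"
    by (auto simp: dga_iso_def)
  then show thesis
    using that \<phi>(2) by blast
qed


section \<open>Coefficients of products of polynomials\<close>

abbreviation lookup where "lookup \<equiv> Poly_Mapping.lookup"
abbreviation keys where "keys \<equiv> Poly_Mapping.keys"

lemma lookup_sqfree:
  assumes "finite I"
  shows "lookup (sqfree I) i = (if i \<in> I then 1 else 0)"
  using assms by (simp add: sqfree_def lookup_sum lookup_single when_def)

lemma keys_sqfree:
  assumes "finite I"
  shows "keys (sqfree I) = I"
  by (auto simp: in_keys_iff lookup_sqfree[OF assms] split: if_splits)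

lemma sqfree_split:
  assumes "finite I" "A \<subseteq> I"
  shows "sqfree A + sqfree (I - A) = sqfree I"
  unfolding sqfree_def by (metis assms finite_subset sum.subset_diff add.commute)

text \<open>The factors of a square-free monomial are square-free. This is why products in
  $\mathcal C^*(K)$ only depend on square-free coefficients.\<close>
lemma sqfree_eq_add_iff:
  assumes "finite I"
  shows "sqfree I = \<alpha> + \<beta> \<longleftrightarrow> (\<exists>A\<subseteq>I. \<alpha> = sqfree A \<and> \<beta> = sqfree (I - A))"
proof
  assume eq: "sqfree I = \<alpha> + \<beta>"
  have l: "lookup \<alpha> i + lookup \<beta> i = (if i \<in> I then 1 else 0)" for i
    using lookup_sqfree[OF assms, of i] by (simp add: eq lookup_add)
  define A where "A = {i. lookup \<alpha> i \<noteq> 0}"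
  have A: "A \<subseteq> I"
  proof
    fix i assume "i \<in> A"
    then show "i \<in> I" using l[of i] by (simp add: A_def split: if_splits)
  qed
  have "lookup \<alpha> i = (if i \<in> A then 1 else 0)" for i
    using l[of i] by (auto simp: A_def split: if_splits)
  then have "\<alpha> = sqfree A"
    using finite_subset[OF A assms] by (intro poly_mapping_eqI) (simp add: lookup_sqfree)
  moreover have "\<beta> = sqfree (I - A)"
    using eq sqfree_split[OF assms A] unfolding \<open>\<alpha> = sqfree A\<close> by simp
  ultimately show "\<exists>A\<subseteq>I. \<alpha> = sqfree A \<and> \<beta> = sqfree (I - A)"
    using A by blast
qed (auto simp: sqfree_split[OF assms])

lemma keys_add_exponents: "keys (\<alpha> + \<beta> :: nat \<Rightarrow>\<^sub>0 nat) = keys \<alpha> \<union> keys \<beta>"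
  by (auto simp: in_keys_iff lookup_add)

lemma lookup_single_times:
  fixes p :: "(nat \<Rightarrow>\<^sub>0 nat) \<Rightarrow>\<^sub>0 'k::field"
  shows "lookup (Poly_Mapping.single \<beta> c * p) \<alpha> = c * (\<Sum>\<gamma>. lookup p \<gamma> when \<alpha> = \<beta> + \<gamma>)"
proof -
  have "lookup (Poly_Mapping.single \<beta> c * p) \<alpha> =
      (\<Sum>l. c * (\<Sum>\<gamma>. lookup p \<gamma> when \<alpha> = l + \<gamma>) when l = \<beta>)"
    unfolding lookup_mult by (rule Sum_any.cong) (auto simp: lookup_single when_def)
  then show ?thesis by simp
qed

lemma lookup_scalar_times: "lookup (Poly_Mapping.single 0 c * p) \<alpha> = c * lookup p \<alpha>"
  for p :: "(nat \<Rightarrow>\<^sub>0 nat) \<Rightarrow>\<^sub>0 'k::field"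
  by (simp add: lookup_single_times)

lemma lookup_variable_times:
  fixes p :: "(nat \<Rightarrow>\<^sub>0 nat) \<Rightarrow>\<^sub>0 'k::field"
  shows "lookup (vmono (Poly_Mapping.single j 1) * p) \<alpha> =
    (if j \<in> keys \<alpha> then lookup p (\<alpha> - Poly_Mapping.single j 1) else 0)"
proof (cases "j \<in> keys \<alpha>")
  case True
  have "\<alpha> = Poly_Mapping.single j 1 + \<gamma> \<longleftrightarrow> \<gamma> = \<alpha> - Poly_Mapping.single j 1" for \<gamma>
  proof
    assume "\<gamma> = \<alpha> - Poly_Mapping.single j 1"
    moreover have "lookup \<alpha> j \<ge> 1" using True by (simp add: in_keys_iff Suc_le_eq)
    ultimately show "\<alpha> = Poly_Mapping.single j 1 + \<gamma>"
      by (intro poly_mapping_eqI) (auto simp: lookup_add lookup_minus lookup_single when_def)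
  qed simp
  then show ?thesis
    using True by (simp add: vmono_def lookup_single_times)
next
  case False
  then have "\<alpha> \<noteq> Poly_Mapping.single j 1 + \<gamma>" for \<gamma>
    by (auto simp: keys_add_exponents)
  with False show ?thesis
    by (simp add: vmono_def lookup_single_times)
qed

lemma lookup_times_sqfree:
  fixes p q :: "(nat \<Rightarrow>\<^sub>0 nat) \<Rightarrow>\<^sub>0 'k::field"
  assumes "finite I"
  shows "lookup (p * q) (sqfree I) = (\<Sum>A\<in>Pow I. lookup p (sqfree A) * lookup q (sqfree (I - A)))"
proof -
  have inj: "inj_on sqfree (Pow I)"
    using assms by (metis (no_types, lifting) PowD finite_subset inj_onI keys_sqfree)
  have inner: "(\<Sum>\<beta>. lookup q \<beta> when sqfree I = sqfree A + \<beta>) = lookup q (sqfree (I - A))" if "A \<subseteq> I" for A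
  proof -
    have "sqfree I = sqfree A + \<beta> \<longleftrightarrow> \<beta> = sqfree (I - A)" for \<beta>
      using sqfree_split[OF assms that] by (metis add_left_cancel)
    then show ?thesis by simp
  qed
  have "(\<Sum>\<beta>. lookup q \<beta> when sqfree I = \<alpha> + \<beta>) = 0" if "\<alpha> \<notin> sqfree ` Pow I" for \<alpha>
  proof -
    have "sqfree I \<noteq> \<alpha> + \<beta>" for \<beta>
      using that by (auto simp: sqfree_eq_add_iff[OF assms])
    then show ?thesis by simp
  qed
  then have "{\<alpha>. lookup p \<alpha> * (\<Sum>\<beta>. lookup q \<beta> when sqfree I = \<alpha> + \<beta>) \<noteq> 0} \<subseteq> sqfree ` Pow I"
    by auto
  then have "lookup (p * q) (sqfree I) =
      (\<Sum>\<alpha>\<in>sqfree ` Pow I. lookup p \<alpha> * (\<Sum>\<beta>. lookup q \<beta> when sqfree I = \<alpha> + \<beta>))"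
    unfolding lookup_mult using assms by (intro Sum_any.expand_superset) auto
  also have "\<dots> = (\<Sum>A\<in>Pow I. lookup p (sqfree A) * lookup q (sqfree (I - A)))"
    unfolding sum.reindex[OF inj] by (intro sum.cong refl) (simp add: inner)
  finally show ?thesis .
qed


section \<open>The face ring in terms of coefficients\<close>

lemma polys_simps [simp]:
  "p \<in> carrier (polys m) \<longleftrightarrow> (\<forall>\<alpha>\<in>keys p. keys \<alpha> \<subseteq> {1..m})"
  "x \<otimes>\<^bsub>polys m\<^esub> y = x * y" "x \<oplus>\<^bsub>polys m\<^esub> y = x + y"
  "\<zero>\<^bsub>polys m\<^esub> = 0" "\<one>\<^bsub>polys m\<^esub> = 1"
  by (simp_all add: polys_def)

lemma polys_mult_closed:
  assumes "p \<in> carrier (polys m)" "q \<in> carrier (polys m)"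
  shows "p * q \<in> carrier (polys m)"
  using assms keys_mult[of p q] by (fastforce simp: keys_add_exponents)

lemma polys_add_closed:
  assumes "p \<in> carrier (polys m)" "q \<in> carrier (polys m)"
  shows "p + q \<in> carrier (polys m)"
  using assms keys_add[of p q] by fastforce

lemma cring_polys: "cring (polys m :: 'k::field mpoly ring)"
proof (rule cringI)
  show "abelian_group (polys m :: 'k mpoly ring)"
  proof (rule abelian_groupI)
    fix p :: "'k mpoly" assume "p \<in> carrier (polys m)"
    then have "- p \<in> carrier (polys m)" "- p + p = 0" by (simp_all add: in_keys_iff)
    then show "\<exists>q\<in>carrier (polys m). q \<oplus>\<^bsub>polys m\<^esub> p = \<zero>\<^bsub>polys m\<^esub>"
      by (metis polys_simps(3,4))
  qed (simp_all add: ac_simps polys_add_closed del: polys_simps(1), simp)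
  show "comm_monoid (polys m :: 'k mpoly ring)"
    by (rule comm_monoidI) (simp_all add: ac_simps polys_mult_closed del: polys_simps(1), simp)
qed (simp add: distrib_right)

lemma polys_minus:
  assumes "p \<in> carrier (polys m)"
  shows "\<ominus>\<^bsub>polys m\<^esub> p = - p"
proof -
  interpret cring "polys m :: 'a mpoly ring" by (rule cring_polys)
  have "- p \<in> carrier (polys m)" using assms by (simp add: in_keys_iff)
  moreover have "- p \<oplus>\<^bsub>polys m\<^esub> p = \<zero>\<^bsub>polys m\<^esub>" by simp
  ultimately show ?thesis using assms minus_equality by blast
qed

text \<open>The coefficient at an arbitrary representative of a coset. It is independent of the choice
  when the support of \<open>\<alpha>\<close> is a simplex, and is only used for such \<open>\<alpha>\<close>.\<close>
definition face_coeff :: "'k::field mpoly set \<Rightarrow> (nat \<Rightarrow>\<^sub>0 nat) \<Rightarrow> 'k" where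
  "face_coeff C \<alpha> = lookup (SOME p. p \<in> C) \<alpha>"

locale simplicial_complex =
  fixes m :: nat and K :: "nat set set"
  assumes complex: "simplicial_complex_on m K"
begin

lemma simplex_subset: "I \<in> K \<Longrightarrow> J \<subseteq> I \<Longrightarrow> J \<in> K"
  using complex by (auto simp: simplicial_complex_on_def)

lemma simplex_vertices: "I \<in> K \<Longrightarrow> I \<subseteq> {1..m}"
  using complex by (auto simp: simplicial_complex_on_def)

lemma empty_simplex: "{} \<in> K"
  using complex by (auto simp: simplicial_complex_on_def)

lemma simplex_finite: "I \<in> K \<Longrightarrow> finite I"
  using simplex_vertices by (meson finite_atLeastAtMost finite_subset)

text \<open>A factor of a monomial supported on a simplex is itself supported on a simplex; so a multiple of
  a polynomial without such monomials has none either.\<close>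
lemma ideal_of_nonfaces:
  "ideal {p \<in> carrier (polys m). \<forall>\<alpha>. keys \<alpha> \<in> K \<longrightarrow> lookup p \<alpha> = 0} (polys m :: 'k::field mpoly ring)"
  (is "ideal ?N ?P")
proof -
  interpret cring ?P by (rule cring_polys)
  have mult: "p * q \<in> ?N" if p: "p \<in> ?N" and q: "q \<in> carrier ?P" for p q
  proof -
    have "lookup (p * q) \<alpha> = 0" if \<alpha>: "keys \<alpha> \<in> K" for \<alpha>
    proof (rule ccontr)
      assume "lookup (p * q) \<alpha> \<noteq> 0"
      then obtain \<beta> \<gamma> where "\<alpha> = \<beta> + \<gamma>" "\<beta> \<in> keys p"
        using keys_mult[of p q] by (auto simp: in_keys_iff)
      then have "keys \<beta> \<in> K" "lookup p \<beta> \<noteq> 0"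
        using \<alpha> simplex_subset[of "keys \<alpha>" "keys \<beta>"] by (auto simp: keys_add_exponents in_keys_iff)
      with p show False by simp
    qed
    moreover have "p * q \<in> carrier ?P"
      using p q by (intro polys_mult_closed) auto
    ultimately show ?thesis by blast
  qed
  show ?thesis
  proof (rule idealI)
    show "ring ?P" by (rule ring_axioms)
    show "subgroup ?N (add_monoid ?P)"
    proof (rule add.subgroupI)
      show "?N \<subseteq> carrier ?P" by blast
      show "?N \<noteq> {}" by (auto intro: exI[of _ 0])
      fix p q assume p: "p \<in> ?N"
      then show "\<ominus>\<^bsub>?P\<^esub> p \<in> ?N" by (auto simp: polys_minus in_keys_iff)
      assume q: "q \<in> ?N"
      have "p + q \<in> carrier ?P" using p q by (intro polys_add_closed) auto
      then show "p \<oplus>\<^bsub>?P\<^esub> q \<in> ?N" using p q by (simp add: lookup_add)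
    qed
    show "q \<otimes>\<^bsub>?P\<^esub> p \<in> ?N" "p \<otimes>\<^bsub>?P\<^esub> q \<in> ?N" if "p \<in> ?N" "q \<in> carrier ?P" for p q
      using mult[OF that] by (simp_all only: polys_simps(2) mult.commute[of q p])
  qed
qed

text \<open>For the inclusion from right to left, a monomial supported on a non-simplex \<open>I\<close> is a multiple of the
  generator $v_I$.\<close>
lemma face_ideal_eq:
  "face_ideal m K = {p \<in> carrier (polys m :: 'k::field mpoly ring). \<forall>\<alpha>. keys \<alpha> \<in> K \<longrightarrow> lookup p \<alpha> = 0}"
proof
  let ?P = "polys m :: 'k mpoly ring"
  let ?G = "{vmono (sqfree I) :: 'k mpoly | I. I \<subseteq> {1..m} \<and> I \<notin> K}"
  interpret cring ?P by (rule cring_polys)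
  have keys_gen: "keys (vmono (sqfree I) :: 'k mpoly) = {sqfree I}" "keys (sqfree I) = I" if "I \<subseteq> {1..m}" for I
    using that by (auto simp: vmono_def keys_sqfree finite_subset)
  then have G: "?G \<subseteq> carrier ?P" by auto
  show "face_ideal m K \<subseteq> {p \<in> carrier ?P. \<forall>\<alpha>. keys \<alpha> \<in> K \<longrightarrow> lookup p \<alpha> = 0}"
    unfolding face_ideal_def
  proof (rule genideal_minimal[OF ideal_of_nonfaces], clarify)
    fix I assume I: "I \<subseteq> {1..m}" "I \<notin> K"
    have "lookup (vmono (sqfree I) :: 'k mpoly) \<alpha> = 0" if "keys \<alpha> \<in> K" for \<alpha>
      using that I keys_gen(2)[OF I(1)] by (auto simp: vmono_def lookup_single when_def)
    then show "vmono (sqfree I) \<in> carrier ?P \<and> (\<forall>\<alpha>. keys \<alpha> \<in> K \<longrightarrow> lookup (vmono (sqfree I) :: 'k mpoly) \<alpha> = 0)"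
      using keys_gen[OF I(1)] I by simp
  qed
  interpret I: ideal "face_ideal m K" ?P
    unfolding face_ideal_def by (rule genideal_ideal[OF G])
  show "{p \<in> carrier ?P. \<forall>\<alpha>. keys \<alpha> \<in> K \<longrightarrow> lookup p \<alpha> = 0} \<subseteq> face_ideal m K"
  proof clarify
    fix p assume p: "p \<in> carrier ?P" "\<forall>\<alpha>. keys \<alpha> \<in> K \<longrightarrow> lookup p \<alpha> = 0"
    have mono: "Poly_Mapping.single \<alpha> (lookup p \<alpha>) \<in> face_ideal m K" if \<alpha>: "\<alpha> \<in> keys p" for \<alpha>
    proof -
      let ?I = "keys \<alpha>"
      have I: "?I \<subseteq> {1..m}" "?I \<notin> K" using p \<alpha> by (auto simp: in_keys_iff)
      have "\<alpha> = sqfree ?I + (\<alpha> - sqfree ?I)"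
        by (rule poly_mapping_eqI) (auto simp: lookup_add lookup_minus lookup_sqfree in_keys_iff)
      then have "Poly_Mapping.single \<alpha> (lookup p \<alpha>) =
          vmono (sqfree ?I) * Poly_Mapping.single (\<alpha> - sqfree ?I) (lookup p \<alpha>)"
        by (simp add: vmono_def mult_single)
      moreover have "Poly_Mapping.single (\<alpha> - sqfree ?I) (lookup p \<alpha>) \<in> carrier ?P"
      proof -
        have "keys (\<alpha> - sqfree ?I) \<subseteq> ?I"
          by (rule subsetI) (simp add: in_keys_iff lookup_minus)
        then show ?thesis using I(1) by auto
      qed
      moreover have "(vmono (sqfree ?I) :: 'k mpoly) \<in> face_ideal m K"
      proof -
        have "(vmono (sqfree ?I) :: 'k mpoly) \<in> ?G" using I by auto
        from subsetD[OF genideal_self[OF G] this] show ?thesis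
          by (simp only: face_ideal_def)
      qed
      ultimately show ?thesis using I.I_r_closed by (simp only: polys_simps(2))
    qed
    have "(\<Sum>\<alpha>\<in>S. Poly_Mapping.single \<alpha> (lookup p \<alpha>)) \<in> face_ideal m K" if "finite S" "S \<subseteq> keys p" for S
      using that
    proof (induction S rule: finite_induct)
      case empty
      then show ?case using I.zero_closed by simp
    next
      case (insert \<alpha> S)
      then show ?case using I.a_closed mono by simp
    qed
    moreover have "p = (\<Sum>\<alpha>\<in>keys p. Poly_Mapping.single \<alpha> (lookup p \<alpha>))"
      by (rule poly_mapping_eqI) (simp add: lookup_sum lookup_single when_def in_keys_iff)
    ultimately show "p \<in> face_ideal m K" by (metis finite_keys order_refl)
  qed
qed

lemma ideal_face_ideal: "ideal (face_ideal m K) (polys m :: 'k::field mpoly ring)"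
  unfolding face_ideal_eq by (rule ideal_of_nonfaces)

lemma face_class_hom: "ring_hom_ring (polys m :: 'k::field mpoly ring) (face_ring m K) (face_class m K)"
  using ideal.rcos_ring_hom_ring[OF ideal_face_ideal]
  unfolding face_ring_def face_class_def[abs_def] by simp

lemma cring_face_ring: "cring (face_ring m K :: 'k::field mpoly set ring)"
  unfolding face_ring_def by (rule ideal.quotient_is_cring[OF ideal_face_ideal cring_polys])

lemma face_ring_cases:
  assumes "C \<in> carrier (face_ring m K)"
  obtains p where "p \<in> carrier (polys m :: 'k::field mpoly ring)" "C = face_class m K p"
  using assms unfolding face_ring_def FactRing_def A_RCOSETS_defs face_class_def a_r_coset_def by auto

lemma face_class_closed: "p \<in> carrier (polys m) \<Longrightarrow> face_class m K p \<in> carrier (face_ring m K)"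
  for p :: "'k::field mpoly"
  by (rule ring_hom_memE(1)[OF ring_hom_ring.homh[OF face_class_hom]])

lemma face_class_add:
  assumes "p \<in> carrier (polys m)" "q \<in> carrier (polys m)"
  shows "face_class m K p \<oplus>\<^bsub>face_ring m K\<^esub> face_class m K q = face_class m K (p + q :: 'k::field mpoly)"
  using ring_hom_memE(3)[OF ring_hom_ring.homh[OF face_class_hom] assms] by (simp only: polys_simps(3))

lemma face_class_mult:
  assumes "p \<in> carrier (polys m)" "q \<in> carrier (polys m)"
  shows "face_class m K p \<otimes>\<^bsub>face_ring m K\<^esub> face_class m K q = face_class m K (p * q :: 'k::field mpoly)"
  using ring_hom_memE(2)[OF ring_hom_ring.homh[OF face_class_hom] assms] by (simp only: polys_simps(2))

lemma face_class_zero: "face_class m K (0 :: 'k::field mpoly) = \<zero>\<^bsub>face_ring m K\<^esub>"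
  using ring_hom_zero[OF ring_hom_ring.homh[OF face_class_hom] cring.axioms(1)[OF cring_polys]
    cring.axioms(1)[OF cring_face_ring]] by (simp only: polys_simps(4))

lemma face_class_one: "face_class m K (1 :: 'k::field mpoly) = \<one>\<^bsub>face_ring m K\<^esub>"
  using ring_hom_memE(4)[OF ring_hom_ring.homh[OF face_class_hom]] by (simp only: polys_simps(5))

lemma face_coeff_class:
  assumes p: "p \<in> carrier (polys m)" and \<alpha>: "keys \<alpha> \<in> K"
  shows "face_coeff (face_class m K p) \<alpha> = lookup (p :: 'k::field mpoly) \<alpha>"
proof -
  interpret I: ideal "face_ideal m K" "polys m :: 'k mpoly ring" by (rule ideal_face_ideal)
  have "p \<in> face_class m K p"
    unfolding face_class_def by (rule I.a_rcos_self[OF p])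
  then have "(SOME q. q \<in> face_class m K p) \<in> face_class m K p" by (rule someI)
  then obtain h where "h \<in> face_ideal m K" "(SOME q. q \<in> face_class m K p) = h + p"
    unfolding face_class_def a_r_coset_def r_coset_def by auto
  then show ?thesis
    using \<alpha> by (simp add: face_coeff_def face_ideal_eq lookup_add)
qed

text \<open>The difference of representatives has no monomial supported on a simplex, and so lies in the
  face ideal.\<close>
lemma face_coeff_eqI:
  assumes C: "C \<in> carrier (face_ring m K)" and D: "D \<in> carrier (face_ring m K)"
    and eq: "\<And>\<alpha>. keys \<alpha> \<in> K \<Longrightarrow> face_coeff C \<alpha> = (face_coeff D \<alpha> :: 'k::field)"
  shows "C = D"
proof -
  interpret P: cring "polys m :: 'k mpoly ring" by (rule cring_polys)
  obtain p q where p: "p \<in> carrier (polys m)" "C = face_class m K p"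
    and q: "q \<in> carrier (polys m)" "D = face_class m K q"
    using face_ring_cases C D by metis
  have "p \<ominus>\<^bsub>polys m\<^esub> q = p - q"
    using q by (simp add: a_minus_def polys_minus del: polys_simps(1))
  moreover have "p \<ominus>\<^bsub>polys m\<^esub> q \<in> carrier (polys m)"
    using p q by (intro P.minus_closed)
  moreover have "lookup p \<alpha> = lookup q \<alpha>" if "keys \<alpha> \<in> K" for \<alpha>
    using eq[OF that] p q that by (simp only: face_coeff_class)
  ultimately have "p \<ominus>\<^bsub>polys m\<^esub> q \<in> face_ideal m K"
    unfolding face_ideal_eq by (simp add: lookup_minus)
  then show ?thesis
    using p q P.quotient_eq_iff_same_a_r_cos[OF ideal_face_ideal] by (simp add: face_class_def)
qed

lemma face_coeff_surj:
  assumes "finite {\<alpha>. g \<alpha> \<noteq> 0}"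
  obtains C where "C \<in> carrier (face_ring m K)" "\<And>\<alpha>. keys \<alpha> \<in> K \<Longrightarrow> face_coeff C \<alpha> = (g \<alpha> :: 'k::field)"
proof -
  define p where "p = Abs_poly_mapping (\<lambda>\<alpha>. if keys \<alpha> \<in> K then g \<alpha> else 0)"
  have "finite {\<alpha>. (if keys \<alpha> \<in> K then g \<alpha> else 0) \<noteq> 0}"
    by (rule finite_subset[OF _ assms]) auto
  then have l: "lookup p \<alpha> = (if keys \<alpha> \<in> K then g \<alpha> else 0)" for \<alpha>
    by (simp add: p_def)
  have "keys \<alpha> \<subseteq> {1..m}" if "\<alpha> \<in> keys p" for \<alpha>
    using that by (intro simplex_vertices) (simp add: in_keys_iff[of \<alpha>] l split: if_splits)
  then have "p \<in> carrier (polys m)" by simp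
  then show thesis
    using that[OF face_class_closed, of p] by (simp add: face_coeff_class l del: polys_simps(1))
qed

lemma finite_face_coeff:
  assumes "C \<in> carrier (face_ring m K)"
  shows "finite {\<alpha>. keys \<alpha> \<in> K \<and> face_coeff C \<alpha> \<noteq> (0::'k::field)}"
proof -
  obtain p where p: "p \<in> carrier (polys m)" "C = face_class m K p"
    using face_ring_cases assms by metis
  have "{\<alpha>. keys \<alpha> \<in> K \<and> face_coeff C \<alpha> \<noteq> 0} \<subseteq> keys p"
    using p by (auto simp: face_coeff_class in_keys_iff simp del: polys_simps(1))
  then show ?thesis by (rule finite_subset) simp
qed

lemma face_coeff_zero: "keys \<alpha> \<in> K \<Longrightarrow> face_coeff \<zero>\<^bsub>face_ring m K\<^esub> \<alpha> = (0::'k::field)"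
  by (simp add: face_class_zero[symmetric] face_coeff_class)

lemma face_coeff_add:
  assumes "C \<in> carrier (face_ring m K)" "D \<in> carrier (face_ring m K)" "keys \<alpha> \<in> K"
  shows "face_coeff (C \<oplus>\<^bsub>face_ring m K\<^esub> D) \<alpha> = (face_coeff C \<alpha> + face_coeff D \<alpha> :: 'k::field)"
proof -
  obtain p q where "p \<in> carrier (polys m)" "C = face_class m K p"
    and "q \<in> carrier (polys m)" "D = face_class m K q"
    using face_ring_cases assms(1,2) by metis
  then show ?thesis
    using assms(3) by (simp only: face_class_add face_coeff_class polys_add_closed lookup_add)
qed

lemma face_coeff_minus:
  assumes "C \<in> carrier (face_ring m K)" "keys \<alpha> \<in> K"
  shows "face_coeff (\<ominus>\<^bsub>face_ring m K\<^esub> C) \<alpha> = - (face_coeff C \<alpha> :: 'k::field)"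
proof -
  interpret cring "face_ring m K :: 'k mpoly set ring" by (rule cring_face_ring)
  have "face_coeff (\<ominus>\<^bsub>face_ring m K\<^esub> C \<oplus>\<^bsub>face_ring m K\<^esub> C) \<alpha> = 0"
    using assms by (simp add: l_neg face_coeff_zero)
  then show ?thesis
    using assms by (simp add: face_coeff_add eq_neg_iff_add_eq_0)
qed

lemma face_coeff_sign:
  assumes "C \<in> carrier (face_ring m K)" "keys \<alpha> \<in> K"
  shows "face_coeff (add_pow (face_ring m K) ((-1::int) ^ n) C) \<alpha> = (-1) ^ n * (face_coeff C \<alpha> :: 'k::field)"
proof -
  interpret cring "face_ring m K :: 'k mpoly set ring" by (rule cring_face_ring)
  show ?thesis using assms by (simp add: add_pow_sign face_coeff_minus)
qed

lemma face_coeff_finsum: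
  assumes "finite S" "f \<in> S \<rightarrow> carrier (face_ring m K)" "keys \<alpha> \<in> K"
  shows "face_coeff (finsum (face_ring m K) f S) \<alpha> = (\<Sum>s\<in>S. face_coeff (f s) \<alpha> :: 'k::field)"
proof -
  interpret cring "face_ring m K :: 'k mpoly set ring" by (rule cring_face_ring)
  show ?thesis
    using assms
  proof (induction S rule: finite_induct)
    case (insert s S)
    then have "finsum (face_ring m K) f (insert s S) = f s \<oplus>\<^bsub>face_ring m K\<^esub> finsum (face_ring m K) f S"
      by (intro finsum_insert) auto
    moreover have "f s \<in> carrier (face_ring m K)" "f \<in> S \<rightarrow> carrier (face_ring m K)"
      using insert.prems by auto
    ultimately show ?case
      using insert by (simp add: face_coeff_add)
  qed (simp add: face_coeff_zero)
qed

lemma face_scalar_closed: "face_class m K (Poly_Mapping.single 0 c) \<in> carrier (face_ring m K)" for c :: "'k::field"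
  by (rule face_class_closed) simp

lemma face_coeff_scalar_times:
  assumes "C \<in> carrier (face_ring m K)" "keys \<alpha> \<in> K"
  shows "face_coeff (face_class m K (Poly_Mapping.single 0 c) \<otimes>\<^bsub>face_ring m K\<^esub> C) \<alpha> = (c * face_coeff C \<alpha> :: 'k::field)"
proof -
  obtain p where p: "p \<in> carrier (polys m)" "C = face_class m K p"
    using face_ring_cases assms(1) by metis
  have c: "Poly_Mapping.single 0 c \<in> carrier (polys m)" by simp
  show ?thesis
    unfolding p(2) face_class_mult[OF c p(1)] face_coeff_class[OF polys_mult_closed[OF c p(1)] assms(2)]
      face_coeff_class[OF p(1) assms(2)] by (rule lookup_scalar_times)
qed

lemma face_variable_closed:
  "j \<in> {1..m} \<Longrightarrow> face_class m K (vmono (Poly_Mapping.single j 1)) \<in> carrier (face_ring m K :: 'k::field mpoly set ring)"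
  by (rule face_class_closed) (simp add: vmono_def)

lemma face_coeff_variable_times:
  assumes "C \<in> carrier (face_ring m K)" "keys \<alpha> \<in> K" "j \<in> {1..m}"
  shows "face_coeff (face_class m K (vmono (Poly_Mapping.single j 1)) \<otimes>\<^bsub>face_ring m K\<^esub> C) \<alpha> =
    (if j \<in> keys \<alpha> then face_coeff C (\<alpha> - Poly_Mapping.single j 1) else 0 :: 'k::field)"
proof -
  obtain p where p: "p \<in> carrier (polys m)" "C = face_class m K p"
    using face_ring_cases assms(1) by metis
  have v: "vmono (Poly_Mapping.single j 1) \<in> carrier (polys m :: 'k mpoly ring)"
    using assms(3) by (simp add: vmono_def)
  have "keys (\<alpha> - Poly_Mapping.single j 1) \<in> K"
    by (rule simplex_subset[OF assms(2)]) (auto simp: in_keys_iff lookup_minus)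
  then show ?thesis
    unfolding p(2) face_class_mult[OF v p(1)] face_coeff_class[OF polys_mult_closed[OF v p(1)] assms(2)]
    by (simp only: lookup_variable_times face_coeff_class[OF p(1)])
qed

lemma face_coeff_mult_sqfree:
  assumes "C \<in> carrier (face_ring m K)" "D \<in> carrier (face_ring m K)" "I \<in> K"
  shows "face_coeff (C \<otimes>\<^bsub>face_ring m K\<^esub> D) (sqfree I) =
    (\<Sum>A\<in>Pow I. face_coeff C (sqfree A) * face_coeff D (sqfree (I - A)) :: 'k::field)"
proof -
  obtain p q where p: "p \<in> carrier (polys m)" "C = face_class m K p"
    and q: "q \<in> carrier (polys m)" "D = face_class m K q"
    using face_ring_cases assms(1,2) by metis
  have fin: "finite I" using assms(3) by (rule simplex_finite)
  have faces: "keys (sqfree A) \<in> K" if "A \<subseteq> I" for A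
    using simplex_subset[OF assms(3) that] finite_subset[OF that fin] by (simp add: keys_sqfree)
  show ?thesis
    unfolding p(2) q(2) face_class_mult[OF p(1) q(1)]
      face_coeff_class[OF polys_mult_closed[OF p(1) q(1)] faces[OF subset_refl]] lookup_times_sqfree[OF fin]
    by (intro sum.cong refl) (simp add: face_coeff_class[OF p(1)] face_coeff_class[OF q(1)] faces)
qed


section \<open>The exterior algebra over the face ring\<close>

lemma koszul_simps:
  "carrier (koszul_module m K) = Pow {1..m} \<rightarrow>\<^sub>E carrier (face_ring m K)"
  "x \<oplus>\<^bsub>koszul_module m K\<^esub> y = (\<lambda>L\<in>Pow {1..m}. x L \<oplus>\<^bsub>face_ring m K\<^esub> y L)"
  "\<zero>\<^bsub>koszul_module m K\<^esub> = (\<lambda>L\<in>Pow {1..m}. \<zero>\<^bsub>face_ring m K\<^esub>)"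
  "\<one>\<^bsub>koszul_module m K\<^esub> = (\<lambda>L\<in>Pow {1..m}. if L = {} then \<one>\<^bsub>face_ring m K\<^esub> else \<zero>\<^bsub>face_ring m K\<^esub>)"
  "c \<odot>\<^bsub>koszul_module m K\<^esub> x =
    (\<lambda>L\<in>Pow {1..m}. face_class m K (Poly_Mapping.single 0 c) \<otimes>\<^bsub>face_ring m K\<^esub> x L)"
  "x \<otimes>\<^bsub>koszul_module m K\<^esub> y = (\<lambda>L\<in>Pow {1..m}. \<Oplus>\<^bsub>face_ring m K\<^esub> J\<in>Pow L.
    add_pow (face_ring m K) ((-1::int) ^ inversions J (L - J)) (x J \<otimes>\<^bsub>face_ring m K\<^esub> y (L - J)))"
  by (simp_all add: koszul_module_def Let_def)

lemma koszul_component: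
  "x \<in> carrier (koszul_module m K) \<Longrightarrow> L \<subseteq> {1..m} \<Longrightarrow> x L \<in> carrier (face_ring m K)"
  by (auto simp: koszul_simps)

lemma koszul_eqI:
  assumes "x \<in> carrier (koszul_module m K)" "y \<in> carrier (koszul_module m K)"
    and "\<And>L \<alpha>. L \<subseteq> {1..m} \<Longrightarrow> keys \<alpha> \<in> K \<Longrightarrow> face_coeff (x L) \<alpha> = (face_coeff (y L) \<alpha> :: 'k::field)"
  shows "x = y"
proof (rule PiE_ext)
  show "x \<in> Pow {1..m} \<rightarrow>\<^sub>E carrier (face_ring m K)" "y \<in> Pow {1..m} \<rightarrow>\<^sub>E carrier (face_ring m K)"
    using assms(1,2) by (simp_all add: koszul_simps)
  show "x L = y L" if "L \<in> Pow {1..m}" for L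
    using that assms by (intro face_coeff_eqI koszul_component) auto
qed

lemma koszul_add_closed:
  assumes "x \<in> carrier (koszul_module m K)" "y \<in> carrier (koszul_module m K)"
  shows "x \<oplus>\<^bsub>koszul_module m K\<^esub> y \<in> carrier (koszul_module m K :: ('k::field, _) module)"
proof -
  interpret cring "face_ring m K :: 'k mpoly set ring" by (rule cring_face_ring)
  show ?thesis using assms by (auto simp: koszul_simps)
qed

lemma koszul_coeff_add:
  assumes "x \<in> carrier (koszul_module m K)" "y \<in> carrier (koszul_module m K)" "L \<subseteq> {1..m}" "keys \<alpha> \<in> K"
  shows "face_coeff ((x \<oplus>\<^bsub>koszul_module m K\<^esub> y) L) \<alpha> = (face_coeff (x L) \<alpha> + face_coeff (y L) \<alpha> :: 'k::field)"
  using assms by (simp add: koszul_simps(2) face_coeff_add koszul_component)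

lemma koszul_zero_closed: "\<zero>\<^bsub>koszul_module m K\<^esub> \<in> carrier (koszul_module m K :: ('k::field, _) module)"
proof -
  interpret cring "face_ring m K :: 'k mpoly set ring" by (rule cring_face_ring)
  show ?thesis by (auto simp: koszul_simps)
qed

lemma koszul_coeff_zero:
  assumes "L \<subseteq> {1..m}" "keys \<alpha> \<in> K"
  shows "face_coeff (\<zero>\<^bsub>koszul_module m K\<^esub> L) \<alpha> = (0 :: 'k::field)"
  using assms by (simp add: koszul_simps face_coeff_zero)

lemma koszul_smult_closed:
  assumes "x \<in> carrier (koszul_module m K)"
  shows "c \<odot>\<^bsub>koszul_module m K\<^esub> x \<in> carrier (koszul_module m K :: ('k::field, _) module)"
proof -
  interpret cring "face_ring m K :: 'k mpoly set ring" by (rule cring_face_ring)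
  show ?thesis using assms face_scalar_closed by (auto simp: koszul_simps)
qed

lemma koszul_coeff_smult:
  assumes "x \<in> carrier (koszul_module m K)" "L \<subseteq> {1..m}" "keys \<alpha> \<in> K"
  shows "face_coeff ((c \<odot>\<^bsub>koszul_module m K\<^esub> x) L) \<alpha> = (c * face_coeff (x L) \<alpha> :: 'k::field)"
  using assms by (simp add: koszul_simps(5) face_coeff_scalar_times koszul_component)

lemma koszul_mult_closed:
  assumes "x \<in> carrier (koszul_module m K)" "y \<in> carrier (koszul_module m K)"
  shows "x \<otimes>\<^bsub>koszul_module m K\<^esub> y \<in> carrier (koszul_module m K :: ('k::field, _) module)"
proof -
  interpret cring "face_ring m K :: 'k mpoly set ring" by (rule cring_face_ring)
  have "x J \<otimes>\<^bsub>face_ring m K\<^esub> y (L - J) \<in> carrier (face_ring m K)" if "L \<subseteq> {1..m}" "J \<subseteq> L" for L J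
    using that assms by (intro m_closed koszul_component) auto
  then have "(\<Oplus>\<^bsub>face_ring m K\<^esub> J\<in>Pow L. add_pow (face_ring m K) ((-1::int) ^ inversions J (L - J))
      (x J \<otimes>\<^bsub>face_ring m K\<^esub> y (L - J))) \<in> carrier (face_ring m K)" if "L \<subseteq> {1..m}" for L
    using that by (intro finsum_closed) auto
  then show ?thesis
    unfolding koszul_simps(1,6) by auto
qed

text \<open>At a square-free exponent the product of the exterior algebra already has the structure
  constants \<open>monomial_mult\<close>: the subsets of \<open>L\<close> come from the product of the $u_j$, and those of
  \<open>I\<close> from the product of polynomials.\<close>
lemma koszul_coeff_mult:
  assumes "x \<in> carrier (koszul_module m K)" "y \<in> carrier (koszul_module m K)" "L \<subseteq> {1..m}" "I \<in> K"
  shows "face_coeff ((x \<otimes>\<^bsub>koszul_module m K\<^esub> y) L) (sqfree I) =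
    (monomial_mult (\<lambda>A B. face_coeff (x B) (sqfree A)) (\<lambda>A B. face_coeff (y B) (sqfree A)) I L :: 'k::field)"
proof -
  interpret cring "face_ring m K :: 'k mpoly set ring" by (rule cring_face_ring)
  have fin: "finite L" "finite I" using assms(3,4) simplex_finite by (auto intro: finite_subset)
  have I: "keys (sqfree I) \<in> K" using assms(4) fin by (simp add: keys_sqfree)
  have comp: "x J \<in> carrier (face_ring m K)" "y (L - J) \<in> carrier (face_ring m K)" if "J \<subseteq> L" for J
    using that assms by (auto intro!: koszul_component)
  have "face_coeff ((x \<otimes>\<^bsub>koszul_module m K\<^esub> y) L) (sqfree I) =
      (\<Sum>J\<in>Pow L. face_coeff (add_pow (face_ring m K) ((-1::int) ^ inversions J (L - J))
        (x J \<otimes>\<^bsub>face_ring m K\<^esub> y (L - J))) (sqfree I))"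
    using assms(3) comp fin I by (simp add: koszul_simps(6), subst face_coeff_finsum) auto
  also have "\<dots> = (\<Sum>J\<in>Pow L. \<Sum>A\<in>Pow I. (-1) ^ inversions J (L - J) *
      (face_coeff (x J) (sqfree A) * face_coeff (y (L - J)) (sqfree (I - A))))"
  proof (intro sum.cong refl)
    fix J assume "J \<in> Pow L"
    then have c: "x J \<in> carrier (face_ring m K)" "y (L - J) \<in> carrier (face_ring m K)"
      using comp by auto
    show "face_coeff (add_pow (face_ring m K) ((-1::int) ^ inversions J (L - J))
        (x J \<otimes>\<^bsub>face_ring m K\<^esub> y (L - J))) (sqfree I) =
        (\<Sum>A\<in>Pow I. (-1) ^ inversions J (L - J) *
          (face_coeff (x J) (sqfree A) * face_coeff (y (L - J)) (sqfree (I - A))))"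
      unfolding face_coeff_sign[OF m_closed[OF c] I] face_coeff_mult_sqfree[OF c assms(4)]
      by (rule sum_distrib_left)
  qed
  also have "\<dots> = monomial_mult (\<lambda>A B. face_coeff (x B) (sqfree A)) (\<lambda>A B. face_coeff (y B) (sqfree A)) I L"
    unfolding monomial_mult_def by (rule sum.swap)
  finally show ?thesis .
qed

lemma koszul_diff_component_closed:
  assumes "x \<in> carrier (koszul_module m K)" "L \<subseteq> {1..m}" "j \<in> {1..m}"
  shows "face_class m K (vmono (Poly_Mapping.single j 1)) \<otimes>\<^bsub>face_ring m K\<^esub> x (insert j L)
    \<in> carrier (face_ring m K :: 'k::field mpoly set ring)"
proof -
  interpret cring "face_ring m K :: 'k mpoly set ring" by (rule cring_face_ring)
  show ?thesis using assms by (intro m_closed face_variable_closed koszul_component) auto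
qed

lemma koszul_diff_closed:
  assumes "x \<in> carrier (koszul_module m K)"
  shows "koszul_diff m K x \<in> carrier (koszul_module m K :: ('k::field, _) module)"
proof -
  interpret cring "face_ring m K :: 'k mpoly set ring" by (rule cring_face_ring)
  have "(\<Oplus>\<^bsub>face_ring m K\<^esub> j\<in>{1..m} - L. add_pow (face_ring m K) ((-1::int) ^ card {i\<in>L. i < j})
      (face_class m K (vmono (Poly_Mapping.single j 1)) \<otimes>\<^bsub>face_ring m K\<^esub> x (insert j L)))
      \<in> carrier (face_ring m K)" if "L \<subseteq> {1..m}" for L
    using koszul_diff_component_closed[OF assms that] by (intro finsum_closed) auto
  then show ?thesis
    unfolding koszul_simps(1) koszul_diff_def Let_def by auto
qed

lemma koszul_coeff_diff:
  assumes "x \<in> carrier (koszul_module m K)" "L \<subseteq> {1..m}" "keys \<alpha> \<in> K"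
  shows "face_coeff (koszul_diff m K x L) \<alpha> = (\<Sum>j\<in>keys \<alpha> - L. (-1) ^ card {i\<in>L. i < j} *
    (face_coeff (x (insert j L)) (\<alpha> - Poly_Mapping.single j 1) :: 'k::field))"
proof -
  interpret cring "face_ring m K :: 'k mpoly set ring" by (rule cring_face_ring)
  let ?f = "\<lambda>j. (-1) ^ card {i\<in>L. i < j} *
    (face_coeff (x (insert j L)) (\<alpha> - Poly_Mapping.single j 1) :: 'k)"
  have "koszul_diff m K x L = (\<Oplus>\<^bsub>face_ring m K\<^esub> j\<in>{1..m} - L.
      add_pow (face_ring m K) ((-1::int) ^ card {i\<in>L. i < j})
      (face_class m K (vmono (Poly_Mapping.single j 1)) \<otimes>\<^bsub>face_ring m K\<^esub> x (insert j L)))"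
    using assms(2) unfolding koszul_diff_def Let_def by simp
  then have "face_coeff (koszul_diff m K x L) \<alpha> = (\<Sum>j\<in>{1..m} - L. face_coeff
      (add_pow (face_ring m K) ((-1::int) ^ card {i\<in>L. i < j})
      (face_class m K (vmono (Poly_Mapping.single j 1)) \<otimes>\<^bsub>face_ring m K\<^esub> x (insert j L))) \<alpha>)"
    using koszul_diff_component_closed[OF assms(1,2)]
    by (simp only:, intro face_coeff_finsum assms(3)) auto
  also have "\<dots> = (\<Sum>j\<in>{1..m} - L. if j \<in> keys \<alpha> then ?f j else 0)"
  proof (intro sum.cong refl)
    fix j assume j: "j \<in> {1..m} - L"
    then have "x (insert j L) \<in> carrier (face_ring m K)"
      using assms by (intro koszul_component) auto
    then show "face_coeff (add_pow (face_ring m K) ((-1::int) ^ card {i\<in>L. i < j})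
        (face_class m K (vmono (Poly_Mapping.single j 1)) \<otimes>\<^bsub>face_ring m K\<^esub> x (insert j L))) \<alpha> =
        (if j \<in> keys \<alpha> then ?f j else 0)"
      using j assms koszul_diff_component_closed[OF assms(1,2)]
      by (simp add: face_coeff_sign face_coeff_variable_times[unfolded One_nat_def])
  qed
  also have "\<dots> = (\<Sum>j\<in>{j \<in> {1..m} - L. j \<in> keys \<alpha>}. ?f j)"
    by (rule sum.inter_filter[symmetric]) simp
  also have "{j \<in> {1..m} - L. j \<in> keys \<alpha>} = keys \<alpha> - L"
    using simplex_vertices[OF assms(3)] by auto
  finally show ?thesis .
qed

lemma koszul_coeff_surj:
  assumes "\<And>L. finite {\<alpha>. g L \<alpha> \<noteq> (0 :: 'k::field)}"
  obtains x where "x \<in> carrier (koszul_module m K)"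
    "\<And>L \<alpha>. L \<subseteq> {1..m} \<Longrightarrow> keys \<alpha> \<in> K \<Longrightarrow> face_coeff (x L) \<alpha> = g L \<alpha>"
proof -
  have "\<exists>C\<in>carrier (face_ring m K). \<forall>\<alpha>. keys \<alpha> \<in> K \<longrightarrow> face_coeff C \<alpha> = g L \<alpha>" for L
    using face_coeff_surj[OF assms[of L]] by metis
  then obtain h where h: "\<And>L. h L \<in> carrier (face_ring m K)"
      "\<And>L \<alpha>. keys \<alpha> \<in> K \<Longrightarrow> face_coeff (h L) \<alpha> = g L \<alpha>"
    by metis
  show thesis
    by (rule that[of "restrict h (Pow {1..m})"]) (auto simp: koszul_simps h)
qed

lemma finite_koszul_support:
  assumes "x \<in> carrier (koszul_module m K)"
  shows "finite {(L, \<alpha>). L \<subseteq> {1..m} \<and> keys \<alpha> \<in> K \<and> face_coeff (x L) \<alpha> \<noteq> (0 :: 'k::field)}"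
proof -
  have "{(L, \<alpha>). L \<subseteq> {1..m} \<and> keys \<alpha> \<in> K \<and> face_coeff (x L) \<alpha> \<noteq> 0} =
      (SIGMA L:Pow {1..m}. {\<alpha>. keys \<alpha> \<in> K \<and> face_coeff (x L) \<alpha> \<noteq> 0})"
    by auto
  moreover have "finite \<dots>"
    using assms by (intro finite_SigmaI finite_face_coeff koszul_component) auto
  ultimately show ?thesis by simp
qed

lemma koszul_is_module: "module scalars (koszul_module m K :: ('k::field, _) module)"
proof (rule moduleI)
  show "cring (scalars :: 'k ring)" by (rule cring_from_type_algebra)
  show "abelian_group (koszul_module m K :: ('k, _) module)"
  proof (rule abelian_groupI)
    fix x :: "nat set \<Rightarrow> 'k mpoly set" assume x: "x \<in> carrier (koszul_module m K)"
    have "(-1) \<odot>\<^bsub>koszul_module m K\<^esub> x \<oplus>\<^bsub>koszul_module m K\<^esub> x = \<zero>\<^bsub>koszul_module m K\<^esub>"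
      using x by (intro koszul_eqI) (simp_all add: koszul_add_closed koszul_smult_closed koszul_zero_closed
          koszul_coeff_add koszul_coeff_smult koszul_coeff_zero)
    then show "\<exists>y\<in>carrier (koszul_module m K). y \<oplus>\<^bsub>koszul_module m K\<^esub> x = \<zero>\<^bsub>koszul_module m K\<^esub>"
      using koszul_smult_closed[OF x] by blast
  qed (auto intro!: koszul_eqI simp: koszul_add_closed koszul_zero_closed koszul_coeff_add koszul_coeff_zero)
qed (auto intro!: koszul_eqI simp: koszul_add_closed koszul_smult_closed koszul_coeff_add
    koszul_coeff_smult ring_of_type_algebra_def algebra_simps)

lemma kmono_closed:
  assumes "keys \<alpha> \<subseteq> {1..m}"
  shows "kmono m K \<alpha> J \<in> carrier (koszul_module m K :: ('k::field, _) module)"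
proof -
  interpret cring "face_ring m K :: 'k mpoly set ring" by (rule cring_face_ring)
  have "face_class m K (vmono \<alpha> :: 'k mpoly) \<in> carrier (face_ring m K)"
    using assms by (intro face_class_closed) (simp add: vmono_def)
  then show ?thesis
    by (auto simp: koszul_simps kmono_def)
qed

lemma koszul_coeff_kmono:
  assumes "keys \<alpha> \<subseteq> {1..m}" "L \<subseteq> {1..m}" "keys \<beta> \<in> K"
  shows "face_coeff (kmono m K \<alpha> J L) \<beta> = (if L = J \<and> \<beta> = \<alpha> then 1 else 0 :: 'k::field)"
proof -
  have v: "(vmono \<alpha> :: 'k mpoly) \<in> carrier (polys m)"
    using assms by (simp add: vmono_def)
  have "face_coeff (face_class m K (vmono \<alpha>)) \<beta> = (if \<beta> = \<alpha> then 1 else 0 :: 'k)"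
    unfolding face_coeff_class[OF v assms(3)] by (auto simp: vmono_def lookup_single when_def)
  then show ?thesis
    using assms by (auto simp: kmono_def face_coeff_zero)
qed

lemma koszul_coeff_minus:
  assumes "x \<in> carrier (koszul_module m K)" "L \<subseteq> {1..m}" "keys \<alpha> \<in> K"
  shows "face_coeff ((\<ominus>\<^bsub>koszul_module m K\<^esub> x) L) \<alpha> = - (face_coeff (x L) \<alpha> :: 'k::field)"
proof -
  interpret module scalars "koszul_module m K :: ('k, _) module" by (rule koszul_is_module)
  have "face_coeff ((\<ominus>\<^bsub>koszul_module m K\<^esub> x \<oplus>\<^bsub>koszul_module m K\<^esub> x) L) \<alpha> = (0 :: 'k)"
    using assms by (simp add: M.l_neg koszul_coeff_zero)
  then show ?thesis
    using assms by (simp add: koszul_coeff_add eq_neg_iff_add_eq_0)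
qed

text \<open>Coefficients at $v^\alpha u_L$ are taken only when the support of \<open>\<alpha>\<close> is a simplex, as the
  other monomials vanish.\<close>
definition koszul_supported ::
    "((nat \<Rightarrow>\<^sub>0 nat) \<Rightarrow> nat set \<Rightarrow> bool) \<Rightarrow> (nat set \<Rightarrow> 'k::field mpoly set) set" where
  "koszul_supported P = {x \<in> carrier (koszul_module m K).
     \<forall>L \<alpha>. L \<subseteq> {1..m} \<longrightarrow> keys \<alpha> \<in> K \<longrightarrow> face_coeff (x L) \<alpha> \<noteq> 0 \<longrightarrow> P \<alpha> L}"

lemma koszul_supported_submodule:
  "submodule (koszul_supported P) scalars (koszul_module m K :: ('k::field, _) module)"
proof -
  interpret module scalars "koszul_module m K :: ('k, _) module" by (rule koszul_is_module)
  show ?thesis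
  proof (rule submoduleI)
    fix a b :: "nat set \<Rightarrow> 'k mpoly set"
    assume a: "a \<in> koszul_supported P" and b: "b \<in> koszul_supported P"
    then have ab: "a \<in> carrier (koszul_module m K)" "b \<in> carrier (koszul_module m K)"
      by (simp_all add: koszul_supported_def)
    have "P \<alpha> L" if L: "L \<subseteq> {1..m}" "keys \<alpha> \<in> K" "face_coeff ((a \<oplus>\<^bsub>koszul_module m K\<^esub> b) L) \<alpha> \<noteq> 0" for L \<alpha>
    proof -
      have "face_coeff (a L) \<alpha> \<noteq> 0 \<or> face_coeff (b L) \<alpha> \<noteq> 0"
        using L(3) unfolding koszul_coeff_add[OF ab L(1,2)] by auto
      then show ?thesis using a b L(1,2) by (auto simp: koszul_supported_def)
    qed
    then show "a \<oplus>\<^bsub>koszul_module m K\<^esub> b \<in> koszul_supported P"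
      using ab by (simp add: koszul_supported_def koszul_add_closed)
  qed (auto simp: koszul_supported_def koszul_zero_closed koszul_coeff_zero koszul_coeff_minus
      koszul_smult_closed koszul_coeff_smult)
qed

text \<open>The elements supported in \<open>P\<close> form a submodule, which gives one inclusion. For the other,
  subtracting one monomial at a time shrinks the support, which is finite.\<close>
lemma mod_span_kmono:
  "mod_span scalars (koszul_module m K)
     {kmono m K \<alpha> J | \<alpha> J. keys \<alpha> \<subseteq> {1..m} \<and> J \<subseteq> {1..m} \<and> P \<alpha> J} =
   (koszul_supported P :: (nat set \<Rightarrow> 'k::field mpoly set) set)"
  (is "mod_span scalars ?E ?G = _")
proof
  interpret module scalars ?E by (rule koszul_is_module)
  have "?G \<subseteq> koszul_supported P"
    by (auto simp: koszul_supported_def kmono_closed koszul_coeff_kmono split: if_splits)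
  then show "mod_span scalars ?E ?G \<subseteq> koszul_supported P"
    unfolding mod_span_def using koszul_supported_submodule by blast
  show "koszul_supported P \<subseteq> mod_span scalars ?E ?G"
  proof
    fix x :: "nat set \<Rightarrow> 'k mpoly set" assume x: "x \<in> koszul_supported P"
    define supp where "supp y = {(L, \<alpha>). L \<subseteq> {1..m} \<and> keys \<alpha> \<in> K \<and> face_coeff (y L) \<alpha> \<noteq> (0::'k)}" for y
    have "x \<in> H" if H: "submodule H scalars ?E" "?G \<subseteq> H" for H
      using x
    proof (induction "card (supp x)" arbitrary: x rule: less_induct)
      case less
      then have xc: "x \<in> carrier ?E" by (simp add: koszul_supported_def)
      have fin: "finite (supp x)" unfolding supp_def by (rule finite_koszul_support[OF xc])
      show "x \<in> H"
      proof (cases "supp x = {}")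
        case True
        then have "x = \<zero>\<^bsub>?E\<^esub>"
          using xc by (intro koszul_eqI) (auto simp: supp_def koszul_zero_closed koszul_coeff_zero)
        then show ?thesis using subgroup.one_closed[OF submodule.axioms(1)[OF H(1)]] by simp
      next
        case False
        then obtain J \<alpha> where J: "J \<subseteq> {1..m}" "keys \<alpha> \<in> K" "face_coeff (x J) \<alpha> \<noteq> (0::'k)"
          by (auto simp: supp_def)
        have P: "P \<alpha> J" using less.prems J by (simp add: koszul_supported_def)
        have \<alpha>: "keys \<alpha> \<subseteq> {1..m}" by (rule simplex_vertices[OF J(2)])
        define c where "c = face_coeff (x J) \<alpha>"
        define y where "y = x \<oplus>\<^bsub>?E\<^esub> (- c) \<odot>\<^bsub>?E\<^esub> kmono m K \<alpha> J"
        have yc: "y \<in> carrier ?E"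
          unfolding y_def by (intro koszul_add_closed koszul_smult_closed kmono_closed xc \<alpha>)
        have coeff_y: "face_coeff (y L) \<beta> = (if L = J \<and> \<beta> = \<alpha> then 0 else face_coeff (x L) \<beta>)"
          if "L \<subseteq> {1..m}" "keys \<beta> \<in> K" for L \<beta>
          using that xc \<alpha> by (simp add: y_def c_def koszul_coeff_add koszul_coeff_smult koszul_coeff_kmono
              koszul_smult_closed kmono_closed)
        have "supp y \<subseteq> supp x - {(J, \<alpha>)}"
          by (auto simp: supp_def coeff_y split: if_splits)
        moreover have "(J, \<alpha>) \<in> supp x" using J by (simp add: supp_def)
        ultimately have "supp y \<subset> supp x" by blast
        then have "card (supp y) < card (supp x)" by (rule psubset_card_mono[OF fin])
        moreover have "y \<in> koszul_supported P"
          using less.prems yc by (auto simp: koszul_supported_def coeff_y split: if_splits)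
        ultimately have "y \<in> H" by (rule less.hyps)
        moreover have "c \<odot>\<^bsub>?E\<^esub> kmono m K \<alpha> J \<in> H"
          using H J \<alpha> P by (intro submodule.smult_closed[OF H(1)]) (auto simp: ring_of_type_algebra_def)
        ultimately have "y \<oplus>\<^bsub>?E\<^esub> c \<odot>\<^bsub>?E\<^esub> kmono m K \<alpha> J \<in> H"
          by (rule submoduleE(5)[OF H(1)])
        moreover have "y \<oplus>\<^bsub>?E\<^esub> c \<odot>\<^bsub>?E\<^esub> kmono m K \<alpha> J = x"
          using xc yc \<alpha> by (intro koszul_eqI) (auto simp: koszul_add_closed koszul_smult_closed kmono_closed
              koszul_coeff_add koszul_coeff_smult koszul_coeff_kmono coeff_y c_def)
        ultimately show ?thesis by simp
      qed
    qed
    then show "x \<in> mod_span scalars ?E ?G"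
      unfolding mod_span_def by blast
  qed
qed


section \<open>The coordinates of $\mathcal C^*(K)$\<close>

text \<open>This lemma and the next two replace spans by vanishing conditions on coefficients, which can be
  checked one coefficient at a time.\<close>
lemma CK_space_eq:
  "CK_space m K = (koszul_supported (\<lambda>\<alpha> J. \<exists>I\<in>K. I \<inter> J = {} \<and> \<alpha> = sqfree I) :: (nat set \<Rightarrow> 'k::field mpoly set) set)"
proof -
  have "{vu m K I J :: nat set \<Rightarrow> 'k mpoly set | I J. I \<in> K \<and> J \<subseteq> {1..m} \<and> I \<inter> J = {}} =
      {kmono m K \<alpha> J | \<alpha> J. keys \<alpha> \<subseteq> {1..m} \<and> J \<subseteq> {1..m} \<and> (\<exists>I\<in>K. I \<inter> J = {} \<and> \<alpha> = sqfree I)}"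
    (is "?V = ?M")
  proof (intro subset_antisym subsetI)
    fix x assume "x \<in> ?V"
    then obtain I J where IJ: "x = kmono m K (sqfree I) J" "I \<in> K" "J \<subseteq> {1..m}" "I \<inter> J = {}"
      by (auto simp: vu_def)
    moreover have "keys (sqfree I) \<subseteq> {1..m}"
      using IJ(2) by (simp only: keys_sqfree simplex_finite simplex_vertices)
    ultimately show "x \<in> ?M" by blast
  next
    fix x assume "x \<in> ?M"
    then show "x \<in> ?V" unfolding vu_def by blast
  qed
  then show ?thesis
    unfolding CK_space_def by (simp only: mod_span_kmono)
qed

lemma CK_kernel_eq: "CK_kernel m K = koszul_supported (\<lambda>\<alpha> J. \<not> (\<exists>I\<in>K. I \<inter> J = {} \<and> \<alpha> = sqfree I))"
  unfolding CK_kernel_def by (rule mod_span_kmono)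

lemma koszul_graded_eq:
  "koszul_graded m K n = koszul_supported (\<lambda>\<alpha> J. 2 * (\<Sum>i\<in>{1..m}. lookup \<alpha> i) + card J = n)"
  unfolding koszul_graded_def by (rule mod_span_kmono)

lemma keys_sqfree_simplex: "I \<in> K \<Longrightarrow> keys (sqfree I) \<in> K"
  by (simp add: keys_sqfree simplex_finite)

definition CK_coord :: "(nat set \<Rightarrow> 'k::field mpoly set) \<Rightarrow> nat set \<Rightarrow> nat set \<Rightarrow> 'k" where
  "CK_coord x I J = face_coeff (x J) (sqfree I)"

lemma CK_space_carrier: "x \<in> CK_space m K \<Longrightarrow> x \<in> carrier (koszul_module m K)"
  by (simp add: CK_space_eq koszul_supported_def)

lemma CK_space_coeff_cases:
  assumes "x \<in> CK_space m K" "L \<subseteq> {1..m}" "keys \<alpha> \<in> K"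
  obtains "face_coeff (x L) \<alpha> = 0" | I where "basis_index m K I L" "\<alpha> = sqfree I"
  using assms unfolding CK_space_eq koszul_supported_def basis_index_def by blast

lemma CK_coord_eqI:
  assumes x: "x \<in> CK_space m K" and y: "y \<in> CK_space m K"
    and eq: "\<And>I J. basis_index m K I J \<Longrightarrow> CK_coord x I J = CK_coord y I J"
  shows "x = y"
proof (rule koszul_eqI)
  fix L and \<alpha> :: "nat \<Rightarrow>\<^sub>0 nat" assume L: "L \<subseteq> {1..m}" "keys \<alpha> \<in> K"
  show "face_coeff (x L) \<alpha> = face_coeff (y L) \<alpha>"
    using eq CK_space_coeff_cases[OF x L] CK_space_coeff_cases[OF y L] unfolding CK_coord_def by metis
qed (use x y in \<open>auto dest: CK_space_carrier\<close>)

lemma CK_coord_surj: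
  obtains x where "x \<in> CK_space m K" "\<And>I J. basis_index m K I J \<Longrightarrow> CK_coord x I J = f I J"
proof -
  define g where "g L \<alpha> = (if \<exists>I. basis_index m K I L \<and> \<alpha> = sqfree I then f (keys \<alpha>) L else 0)" for L \<alpha>
  have "finite {\<alpha>. g L \<alpha> \<noteq> 0}" for L
  proof (rule finite_subset)
    show "{\<alpha>. g L \<alpha> \<noteq> 0} \<subseteq> sqfree ` Pow {1..m}"
      using basis_index_vertices[OF complex] by (auto simp: g_def split: if_splits)
  qed simp
  then obtain x where x: "x \<in> carrier (koszul_module m K)"
      "\<And>L \<alpha>. L \<subseteq> {1..m} \<Longrightarrow> keys \<alpha> \<in> K \<Longrightarrow> face_coeff (x L) \<alpha> = g L \<alpha>"
    using koszul_coeff_surj[of g] by metis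
  show thesis
  proof (rule that)
    show "x \<in> CK_space m K"
      using x by (auto simp: CK_space_eq koszul_supported_def g_def basis_index_def split: if_splits)
    fix I J assume IJ: "basis_index m K I J"
    then have "I \<in> K" "J \<subseteq> {1..m}" by (auto simp: basis_index_def)
    then show "CK_coord x I J = f I J"
      using IJ by (auto simp: CK_coord_def x keys_sqfree_simplex keys_sqfree simplex_finite g_def)
  qed
qed

text \<open>The space and the kernel have complementary supports, so the decomposition of \<open>w\<close> exists and is
  unique, and \<open>w\<close> has the same coordinates as its projection.\<close>
lemma CK_proj:
  assumes w: "w \<in> carrier (koszul_module m K)"
  shows CK_proj_closed: "CK_proj m K w \<in> CK_space m K"
    and CK_coord_proj: "basis_index m K I J \<Longrightarrow> CK_coord (CK_proj m K w) I J = CK_coord w I J"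
proof -
  let ?E = "koszul_module m K"
  let ?dec = "\<lambda>z. z \<in> CK_space m K \<and> (\<exists>r\<in>CK_kernel m K. w = z \<oplus>\<^bsub>?E\<^esub> r)"
  have coord: "CK_coord z I J = CK_coord w I J" if z: "?dec z" and IJ: "basis_index m K I J" for z I J
  proof -
    obtain r where r: "r \<in> CK_kernel m K" "w = z \<oplus>\<^bsub>?E\<^esub> r" using z by blast
    have ij: "I \<in> K" "J \<subseteq> {1..m}" "I \<inter> J = {}" using IJ by (auto simp: basis_index_def)
    have rc: "r \<in> carrier ?E" using r by (simp add: CK_kernel_eq koszul_supported_def)
    have "face_coeff (r J) (sqfree I) = 0"
      using r(1) ij keys_sqfree_simplex[OF ij(1)] unfolding CK_kernel_eq koszul_supported_def by blast
    then show ?thesis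
      unfolding r(2) using z rc ij
      by (simp add: CK_coord_def koszul_coeff_add CK_space_carrier keys_sqfree_simplex)
  qed
  obtain z where z: "z \<in> CK_space m K" "\<And>I J. basis_index m K I J \<Longrightarrow> CK_coord z I J = CK_coord w I J"
    using CK_coord_surj[of "CK_coord w"] by metis
  note zc = CK_space_carrier[OF z(1)]
  define r where "r = w \<oplus>\<^bsub>?E\<^esub> (- 1) \<odot>\<^bsub>?E\<^esub> z"
  have rc: "r \<in> carrier ?E"
    unfolding r_def by (intro koszul_add_closed koszul_smult_closed w zc)
  have coeff_r: "face_coeff (r L) \<alpha> = face_coeff (w L) \<alpha> - face_coeff (z L) \<alpha>"
    if "L \<subseteq> {1..m}" "keys \<alpha> \<in> K" for L \<alpha>
    using that w zc by (simp add: r_def koszul_coeff_add koszul_coeff_smult koszul_smult_closed)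
  have "r \<in> CK_kernel m K"
    unfolding CK_kernel_eq koszul_supported_def
    using rc z(2) by (auto simp: coeff_r CK_coord_def basis_index_def)
  moreover have "w = z \<oplus>\<^bsub>?E\<^esub> r"
    using w zc rc by (intro koszul_eqI koszul_add_closed) (simp_all add: koszul_coeff_add coeff_r)
  ultimately have "?dec z" using z(1) by blast
  moreover have "y = z" if "?dec y" for y
    using that z coord by (intro CK_coord_eqI) auto
  ultimately have "CK_proj m K w = z"
    unfolding CK_proj_def by (rule the_equality)
  then show "CK_proj m K w \<in> CK_space m K"
    and "basis_index m K I J \<Longrightarrow> CK_coord (CK_proj m K w) I J = CK_coord w I J"
    using z by auto
qed

lemma CK_coord_diff:
  assumes "x \<in> carrier (koszul_module m K)" "basis_index m K I J"
  shows "CK_coord (koszul_diff m K x) I J = monomial_diff (CK_coord x) I J"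
proof -
  have IJ: "I \<in> K" "J \<subseteq> {1..m}" "I - J = I" "finite I" "keys (sqfree I) = I"
    using assms(2) simplex_finite by (auto simp: basis_index_def keys_sqfree)
  have "sqfree I - Poly_Mapping.single i 1 = sqfree (I - {i})" if "i \<in> I" for i
    using sqfree_split[OF IJ(4), of "{i}"] that by (simp add: sqfree_def[of "{i}"] flip: One_nat_def)
      (metis add_diff_cancel_left')
  then show ?thesis
    using koszul_coeff_diff[OF assms(1) IJ(2), of "sqfree I"] IJ
    by (simp add: CK_coord_def monomial_diff_def)
qed

text \<open>The differential replaces some $u_j$ by $v_j$. As \<open>j\<close> was not in \<open>I\<close>, the exponent stays
  square-free, and \<open>j\<close> leaves the index set of the $u$'s.\<close>
lemma CK_diff_closed:
  assumes x: "x \<in> CK_space m K"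
  shows "koszul_diff m K x \<in> CK_space m K"
  unfolding CK_space_eq koszul_supported_def
proof (intro CollectI conjI allI impI koszul_diff_closed CK_space_carrier[OF x])
  fix L \<alpha> assume L: "L \<subseteq> {1..m}" "keys \<alpha> \<in> K" and nz: "face_coeff (koszul_diff m K x L) \<alpha> \<noteq> 0"
  then obtain j where j: "j \<in> keys \<alpha> - L" "face_coeff (x (insert j L)) (\<alpha> - Poly_Mapping.single j 1) \<noteq> 0"
    unfolding koszul_coeff_diff[OF CK_space_carrier[OF x] L]
    by (force elim!: sum.not_neutral_contains_not_neutral)
  have "keys (\<alpha> - Poly_Mapping.single j 1) \<in> K"
    by (rule simplex_subset[OF L(2)]) (auto simp: in_keys_iff lookup_minus)
  moreover have "insert j L \<subseteq> {1..m}"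
    using j L simplex_vertices by blast
  ultimately obtain I where I: "I \<in> K" "I \<inter> insert j L = {}" "\<alpha> - Poly_Mapping.single j 1 = sqfree I"
    using x j unfolding CK_space_eq koszul_supported_def by blast
  have "lookup \<alpha> j \<ge> 1" using j by (simp add: in_keys_iff)
  then have "\<alpha> = Poly_Mapping.single j 1 + sqfree I"
    unfolding I(3)[symmetric]
    by (intro poly_mapping_eqI) (auto simp: lookup_add lookup_minus lookup_single when_def)
  then have "\<alpha> = sqfree (insert j I)"
    using I simplex_finite[OF I(1)] by (simp add: sqfree_def)
  moreover have "insert j I \<in> K"
    using L(2) simplex_finite[OF I(1)] unfolding calculation by (simp add: keys_sqfree)
  moreover have "insert j I \<inter> L = {}"
    using I(2) j(1) by auto
  ultimately show "\<exists>I\<in>K. I \<inter> L = {} \<and> \<alpha> = sqfree I"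
    by (intro bexI[of _ "insert j I"] conjI)
qed

lemma CK_graded_eq:
  "CK_space m K \<inter> koszul_graded m K n = {x \<in> CK_space m K.
     \<forall>I J. basis_index m K I J \<and> CK_coord x I J \<noteq> 0 \<longrightarrow> 2 * card I + card J = n}"
proof -
  have sum: "(\<Sum>i\<in>{1..m}. lookup (sqfree I) i) = card I" if "I \<in> K" for I
  proof -
    have "(\<Sum>i\<in>{1..m}. lookup (sqfree I) i) = (\<Sum>i\<in>{1..m}. if i \<in> I then 1 else 0)"
      using simplex_finite[OF that] by (simp only: lookup_sqfree)
    also have "\<dots> = card ({1..m} \<inter> I)" by (simp add: sum.If_cases)
    also have "{1..m} \<inter> I = I" using simplex_vertices[OF that] by blast
    finally show ?thesis .
  qed
  have "x \<in> koszul_graded m K n \<longleftrightarrow>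
      (\<forall>I J. basis_index m K I J \<and> CK_coord x I J \<noteq> 0 \<longrightarrow> 2 * card I + card J = n)"
    if x: "x \<in> CK_space m K" for x
  proof
    assume g: "x \<in> koszul_graded m K n"
    show "\<forall>I J. basis_index m K I J \<and> CK_coord x I J \<noteq> 0 \<longrightarrow> 2 * card I + card J = n"
    proof (intro allI impI, elim conjE)
      fix I J assume IJ: "basis_index m K I J" and nz: "CK_coord x I J \<noteq> 0"
      have "I \<in> K" "J \<subseteq> {1..m}" using IJ by (auto simp: basis_index_def)
      then have "2 * (\<Sum>i\<in>{1..m}. lookup (sqfree I) i) + card J = n"
        using g nz keys_sqfree_simplex[of I]
        unfolding koszul_graded_eq koszul_supported_def CK_coord_def by blast
      then show "2 * card I + card J = n"
        by (simp only: sum[OF \<open>I \<in> K\<close>])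
    qed
  next
    assume g: "\<forall>I J. basis_index m K I J \<and> CK_coord x I J \<noteq> 0 \<longrightarrow> 2 * card I + card J = n"
    show "x \<in> koszul_graded m K n"
      unfolding koszul_graded_eq koszul_supported_def
    proof (intro CollectI conjI allI impI CK_space_carrier[OF x])
      fix L \<alpha> assume L: "L \<subseteq> {1..m}" "keys \<alpha> \<in> K" and nz: "face_coeff (x L) \<alpha> \<noteq> 0"
      then obtain I where I: "basis_index m K I L" "\<alpha> = sqfree I"
        using CK_space_coeff_cases[OF x L] by blast
      moreover have "I \<in> K" using I by (simp add: basis_index_def)
      ultimately show "2 * (\<Sum>i\<in>{1..m}. lookup \<alpha> i) + card L = n"
        using g nz sum by (auto simp: CK_coord_def)
    qed
  qed
  then show ?thesis by blast
qed

lemma koszul_one_closed: "\<one>\<^bsub>koszul_module m K\<^esub> \<in> carrier (koszul_module m K :: ('k::field, _) module)"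
proof -
  interpret cring "face_ring m K :: 'k mpoly set ring" by (rule cring_face_ring)
  show ?thesis by (auto simp: koszul_simps)
qed

lemma CK_coord_koszul_one:
  assumes "basis_index m K I J"
  shows "CK_coord \<one>\<^bsub>koszul_module m K\<^esub> I J = (monomial_one I J :: 'k::field)"
proof -
  have IJ: "I \<in> K" "J \<subseteq> {1..m}" using assms by (auto simp: basis_index_def)
  have one: "(1 :: 'k mpoly) \<in> carrier (polys m)" by simp
  then have "face_coeff \<one>\<^bsub>face_ring m K\<^esub> (sqfree I) = (lookup 1 (sqfree I) :: 'k)"
    using face_coeff_class[OF one keys_sqfree_simplex[OF IJ(1)]] by (simp only: face_class_one)
  also have "\<dots> = (if I = {} then 1 else 0)"
    using keys_sqfree[OF simplex_finite[OF IJ(1)]] by (auto simp: lookup_one when_def sqfree_def)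
  finally show ?thesis
    using IJ keys_sqfree_simplex[OF IJ(1)]
    by (cases "J = {}") (simp_all add: CK_coord_def koszul_simps(4) monomial_one_def face_coeff_zero)
qed

lemma CK_simps:
  "carrier (CK m K) = CK_space m K"
  "x \<otimes>\<^bsub>CK m K\<^esub> y = CK_proj m K (x \<otimes>\<^bsub>koszul_module m K\<^esub> y)"
  "\<one>\<^bsub>CK m K\<^esub> = CK_proj m K \<one>\<^bsub>koszul_module m K\<^esub>"
  "\<zero>\<^bsub>CK m K\<^esub> = \<zero>\<^bsub>koszul_module m K\<^esub>"
  "x \<oplus>\<^bsub>CK m K\<^esub> y = x \<oplus>\<^bsub>koszul_module m K\<^esub> y"
  "c \<odot>\<^bsub>CK m K\<^esub> x = c \<odot>\<^bsub>koszul_module m K\<^esub> x"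
  "graded (CK m K) n = CK_space m K \<inter> koszul_graded m K n"
  "diff (CK m K) = koszul_diff m K"
  by (simp_all add: CK_def Let_def)

theorem CK_coordinates:
  "dga_coordinates m K (CK m K :: ('k::field, nat set \<Rightarrow> 'k mpoly set) dga) CK_coord"
proof -
  interpret E: module scalars "koszul_module m K :: ('k, _) module" by (rule koszul_is_module)
  have sub: "submodule (CK_space m K) scalars (koszul_module m K :: ('k, _) module)"
    unfolding CK_space_eq by (rule koszul_supported_submodule)
  show ?thesis
  proof (unfold_locales, unfold CK_simps)
    fix f :: "nat set \<Rightarrow> nat set \<Rightarrow> 'k"
    show "\<exists>x\<in>CK_space m K. \<forall>I J. basis_index m K I J \<longrightarrow> CK_coord x I J = f I J"
      using CK_coord_surj[of f] by metis
  next
    show "(\<zero>\<^bsub>koszul_module m K\<^esub> :: nat set \<Rightarrow> 'k mpoly set) \<in> CK_space m K"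
      using subgroup.one_closed[OF submodule.axioms(1)[OF sub]] by simp
  next
    fix I J and x y :: "nat set \<Rightarrow> 'k mpoly set" and c :: 'k
    assume IJ: "basis_index m K I J" and x: "x \<in> CK_space m K"
    have ij: "I \<in> K" "J \<subseteq> {1..m}" "keys (sqfree I) \<in> K"
      using IJ keys_sqfree_simplex by (auto simp: basis_index_def)
    note xc = CK_space_carrier[OF x]
    show "CK_coord (c \<odot>\<^bsub>koszul_module m K\<^esub> x) I J = c * CK_coord x I J"
      using xc ij by (simp add: CK_coord_def koszul_coeff_smult)
    show "CK_coord (koszul_diff m K x) I J = monomial_diff (CK_coord x) I J"
      by (rule CK_coord_diff[OF xc IJ])
    assume y: "y \<in> CK_space m K"
    note yc = CK_space_carrier[OF y]
    show "CK_coord (x \<oplus>\<^bsub>koszul_module m K\<^esub> y) I J = CK_coord x I J + CK_coord y I J"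
      using xc yc ij by (simp add: CK_coord_def koszul_coeff_add)
    show "CK_coord (CK_proj m K (x \<otimes>\<^bsub>koszul_module m K\<^esub> y)) I J = monomial_mult (CK_coord x) (CK_coord y) I J"
      unfolding CK_coord_proj[OF koszul_mult_closed[OF xc yc] IJ]
      unfolding CK_coord_def koszul_coeff_mult[OF xc yc ij(2,1)] by (simp add: CK_coord_def[abs_def])
  next
    fix I J assume IJ: "basis_index m K I J"
    show "CK_coord (CK_proj m K \<one>\<^bsub>koszul_module m K\<^esub>) I J = (monomial_one I J :: 'k)"
      by (simp only: CK_coord_proj[OF koszul_one_closed IJ] CK_coord_koszul_one[OF IJ])
    show "CK_coord \<zero>\<^bsub>koszul_module m K\<^esub> I J = (0::'k)"
      using IJ by (simp add: CK_coord_def koszul_coeff_zero basis_index_def keys_sqfree_simplex)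
  next
    fix x :: "nat set \<Rightarrow> 'k mpoly set" and c :: 'k assume "x \<in> CK_space m K"
    then show "c \<odot>\<^bsub>koszul_module m K\<^esub> x \<in> CK_space m K"
      by (intro submodule.smult_closed[OF sub]) (auto simp: ring_of_type_algebra_def)
  qed (auto intro: complex CK_coord_eqI CK_proj_closed koszul_one_closed koszul_mult_closed CK_space_carrier
      CK_diff_closed E.submoduleE(5)[OF sub] simp: CK_graded_eq)
qed

lemma CK_coord_vu:
  assumes "basis_index m K A B" "basis_index m K I J"
  shows "CK_coord (vu m K A B) I J = (if I = A \<and> J = B then 1 else 0 :: 'k::field)"
proof -
  have "A \<in> K" "I \<in> K" "J \<subseteq> {1..m}" using assms by (auto simp: basis_index_def)
  moreover have "sqfree I = sqfree A \<longleftrightarrow> I = A"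
    using \<open>A \<in> K\<close> \<open>I \<in> K\<close> by (metis keys_sqfree simplex_finite)
  moreover have "keys (sqfree A) \<subseteq> {1..m}"
    using simplex_vertices[OF keys_sqfree_simplex[OF \<open>A \<in> K\<close>]] .
  ultimately show ?thesis
    unfolding CK_coord_def vu_def using keys_sqfree_simplex by (subst koszul_coeff_kmono) auto
qed

lemma vu_in_CK:
  assumes "basis_index m K A B"
  shows "vu m K A B \<in> carrier (CK m K)"
proof -
  have "A \<in> K \<and> B \<subseteq> {1..m} \<and> A \<inter> B = {}"
    using assms by (simp add: basis_index_def)
  then show ?thesis
    unfolding CK_simps CK_space_def mod_span_def by blast
qed


section \<open>The coordinates of the cellular cochain algebra\<close>

lemma DT_apply: "i \<in> {1..m} \<Longrightarrow> DT m I J i = (if i \<in> I then CD else if i \<in> J then CT else CPt)"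
  by (simp add: DT_def)

lemma DT_sets:
  assumes "basis_index m K I J"
  shows "{i \<in> {1..m}. DT m I J i = CD} = I" "{i \<in> {1..m}. DT m I J i = CT} = J"
proof -
  have "I \<subseteq> {1..m}" "J \<subseteq> {1..m}" "I \<inter> J = {}"
    using basis_index_vertices[OF complex assms] assms by (auto simp: basis_index_def)
  then show "{i \<in> {1..m}. DT m I J i = CD} = I" "{i \<in> {1..m}. DT m I J i = CT} = J"
    by (auto simp: DT_def split: if_splits)
qed

lemma DT_inject:
  assumes "basis_index m K I J" "basis_index m K A B"
  shows "DT m I J = DT m A B \<longleftrightarrow> I = A \<and> J = B"
  using DT_sets[OF assms(1)] DT_sets[OF assms(2)] by metis

lemma DT_in_cells:
  assumes "basis_index m K I J"
  shows "DT m I J \<in> ZK_cells m K"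
proof -
  have "I \<in> K" "I \<inter> J = {}" using assms by (simp_all add: basis_index_def)
  then show ?thesis
    using DT_in_ZK_cells_iff[OF complex basis_index_vertices[OF complex assms]] by simp
qed

text \<open>A product cell is determined by where it has the factors \<open>CD\<close> and \<open>CT\<close>, and it lies in
  \<open>ZK m K\<close> iff the former places form a simplex.\<close>
lemma ZK_cells_cases:
  assumes "c \<in> ZK_cells m K"
  obtains I J where "basis_index m K I J" "c = DT m I J"
proof -
  define I where "I = {i \<in> {1..m}. c i = CD}"
  define J where "J = {i \<in> {1..m}. c i = CT}"
  have "c \<in> {1..m} \<rightarrow>\<^sub>E UNIV" using assms by (simp add: ZK_cells_def)
  then have "c i = DT m I J i" for i
    by (cases "c i") (auto simp: DT_def I_def J_def PiE_def extensional_def)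
  then have c: "c = DT m I J" by auto
  have sets: "I \<subseteq> {1..m}" "J \<subseteq> {1..m}" "I \<inter> J = {}" by (auto simp: I_def J_def)
  then have "I \<in> K"
    using DT_in_ZK_cells_iff[OF complex sets] assms c by simp
  with sets have "basis_index m K I J" by (simp add: basis_index_def)
  then show thesis using c that by blast
qed

lemma finite_cells: "finite (ZK_cells m K)"
proof (rule finite_subset)
  show "ZK_cells m K \<subseteq> (\<lambda>(I, J). DT m I J) ` (Pow {1..m} \<times> Pow {1..m})"
  proof
    fix c assume "c \<in> ZK_cells m K"
    then obtain I J where IJ: "basis_index m K I J" "c = DT m I J" by (rule ZK_cells_cases)
    then show "c \<in> (\<lambda>(I, J). DT m I J) ` (Pow {1..m} \<times> Pow {1..m})"
      using basis_index_vertices[OF complex IJ(1)] by (intro image_eqI[of _ _ "(I, J)"]) auto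
  qed
qed simp

definition CZK_coord :: "(pcell \<Rightarrow> 'k) \<Rightarrow> nat set \<Rightarrow> nat set \<Rightarrow> 'k::field" where
  "CZK_coord a I J = a (DT m I J)"

lemma pairing_single_sum:
  assumes "finite S"
  shows "pairing a (\<Sum>i\<in>S. Poly_Mapping.single (e i) (s i)) = (\<Sum>i\<in>S. a (e i) * s i)"
  using assms
proof (induction S rule: finite_induct)
  case empty
  then show ?case by (simp add: pairing_def)
next
  case (insert i S)
  have "pairing a (p + q) = pairing a p + pairing a q" for p q
    unfolding pairing_def by (rule setsum_keys_plus_distrib) (simp_all add: distrib_left)
  moreover have "pairing a (Poly_Mapping.single (e i) (s i)) = a (e i) * s i"
    by (simp add: pairing_def)
  ultimately show ?case using insert by simp
qed

lemma DT_exchange: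
  assumes "basis_index m K I J" "i \<in> I"
  shows "(DT m I J)(i := CT) = DT m (I - {i}) (insert i J)"
proof -
  have "i \<in> {1..m}" using basis_index_vertices[OF complex assms(1)] assms(2) by blast
  then show ?thesis by (auto simp: DT_def fun_eq_iff)
qed

lemma even_sum_cong:
  assumes "\<And>i. i \<in> S \<Longrightarrow> even (f i) = even (g i)"
  shows "even (\<Sum>i\<in>S. f i :: nat) = even (\<Sum>i\<in>S. g i :: nat)"
  using assms by (induction S rule: infinite_finite_induct) auto

lemma minus_one_power_eqI: "even a = even b \<Longrightarrow> (-1) ^ a = ((-1) ^ b :: 'k::ring_1)"
  by (metis minus_one_power_iff)

lemma cell_dim_DT:
  assumes "basis_index m K I J" "i \<in> {1..m}"
  shows "cell_dim (DT m I J i) = 2 * (if i \<in> I then 1 else 0) + (if i \<in> J then 1 else 0)"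
  using assms by (auto simp: DT_apply basis_index_def simp del: One_nat_def)

text \<open>The boundary of \<open>D_IT_J\<close> replaces some \<open>D\<close> by \<open>T\<close>, which moves \<open>i\<close> from \<open>I\<close> to \<open>J\<close>. The
  sign counts the dimensions of the preceding factors, of which only the \<open>T\<close> are odd.\<close>
lemma CZK_coord_coboundary:
  assumes "basis_index m K I J"
  shows "pairing a (pcell_boundary m (DT m I J)) = (monomial_diff (CZK_coord a) I J :: 'k::field)"
proof -
  have sgn: "(-1) ^ (\<Sum>j\<in>{1..<i}. cell_dim (DT m I J j)) = ((-1) ^ card {j \<in> J. j < i} :: 'k)" if i: "i \<in> I" for i
  proof -
    have i': "i \<in> {1..m}" using basis_index_vertices[OF complex assms] i by blast
    have "(-1) ^ (\<Sum>j\<in>{1..<i}. cell_dim (DT m I J j)) = ((-1) ^ (\<Sum>j\<in>{1..<i}. if j \<in> J then 1 else 0) :: 'k)"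
    proof (intro minus_one_power_eqI even_sum_cong)
      fix j assume "j \<in> {1..<i}"
      then have "j \<in> {1..m}" using i' by auto
      then show "even (cell_dim (DT m I J j)) = even (if j \<in> J then 1 else 0 :: nat)"
        by (simp only: cell_dim_DT[OF assms]) simp
    qed
    also have "(\<Sum>j\<in>{1..<i}. if j \<in> J then 1 else 0 :: nat) = card ({1..<i} \<inter> J)"
      by (simp add: sum.If_cases)
    also have "{1..<i} \<inter> J = {j \<in> J. j < i}"
      using basis_index_vertices[OF complex assms] by auto
    finally show ?thesis .
  qed
  have fin: "finite I" by (rule basis_index_finite[OF complex assms])
  have "pairing a (pcell_boundary m (DT m I J)) =
      (\<Sum>i\<in>I. a ((DT m I J)(i := CT)) * (-1) ^ (\<Sum>j\<in>{1..<i}. cell_dim (DT m I J j)))"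
    unfolding pcell_boundary_def DT_sets[OF assms] by (rule pairing_single_sum[OF fin])
  also have "\<dots> = monomial_diff (CZK_coord a) I J"
    unfolding monomial_diff_def
  proof (intro sum.cong refl)
    fix i assume "i \<in> I"
    show "a ((DT m I J)(i := CT)) * (-1) ^ (\<Sum>j\<in>{1..<i}. cell_dim (DT m I J j)) =
        (-1) ^ card {j \<in> J. j < i} * CZK_coord a (I - {i}) (insert i J)"
      unfolding sgn[OF \<open>i \<in> I\<close>] DT_exchange[OF assms \<open>i \<in> I\<close>] CZK_coord_def by (rule mult.commute)
  qed
  finally show ?thesis .
qed

lemma inversions_as_sum:
  assumes "B \<subseteq> {1..m}" "B' \<subseteq> {1..m}"
  shows "inversions B B' = (\<Sum>i\<in>{1..m}. \<Sum>j\<in>{1..<i}. if i \<in> B \<and> j \<in> B' then 1 else 0)"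
proof -
  have "(\<Sum>i\<in>{1..m}. \<Sum>j\<in>{1..<i}. if i \<in> B \<and> j \<in> B' then 1 else 0) =
      (\<Sum>(i, j)\<in>(SIGMA i:{1..m}. {1..<i}). if i \<in> B \<and> j \<in> B' then 1 else 0 :: nat)"
    by (rule sum.Sigma) auto
  also have "\<dots> = (\<Sum>p\<in>{p \<in> (SIGMA i:{1..m}. {1..<i}). fst p \<in> B \<and> snd p \<in> B'}. 1)"
    by (subst sum.inter_filter) (auto intro!: sum.cong)
  also have "{p \<in> (SIGMA i:{1..m}. {1..<i}). fst p \<in> B \<and> snd p \<in> B'} =
      {(j, j'). j \<in> B \<and> j' \<in> B' \<and> j' < j}"
    using assms by auto
  finally show ?thesis by (simp add: inversions_def)
qed

text \<open>Modulo two the exponent of the Koszul sign only sees the factors \<open>T\<close>, and so counts the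
  pairs of them that are out of order.\<close>
lemma pcell_mult_coeff_split:
  assumes IJ: "basis_index m K I J" and "A \<subseteq> I" "B \<subseteq> J"
  shows "pcell_mult_coeff m (DT m A B) (DT m (I - A) (J - B)) (DT m I J) = ((-1) ^ inversions B (J - B) :: 'k::field)"
proof -
  have AB: "basis_index m K A B" "basis_index m K (I - A) (J - B)"
    using assms by (auto intro: basis_index_subset[OF complex IJ])
  have disj: "I \<inter> J = {}" and J: "J \<subseteq> {1..m}" using IJ by (auto simp: basis_index_def)
  have "\<forall>i\<in>{1..m}. cell_mult (DT m A B i) (DT m (I - A) (J - B) i) = Some (DT m I J i)"
    using assms(2,3) disj by (auto simp: DT_def)
  moreover have "(-1) ^ (\<Sum>i\<in>{1..m}. \<Sum>j\<in>{1..<i}. cell_dim (DT m A B i) * cell_dim (DT m (I - A) (J - B) j)) =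
      ((-1) ^ (\<Sum>i\<in>{1..m}. \<Sum>j\<in>{1..<i}. if i \<in> B \<and> j \<in> J - B then 1 else 0) :: 'k)"
  proof (intro minus_one_power_eqI even_sum_cong)
    fix i j assume "i \<in> {1..m}" "j \<in> {1..<i}"
    then have "i \<in> {1..m}" "j \<in> {1..m}" by auto
    then show "even (cell_dim (DT m A B i) * cell_dim (DT m (I - A) (J - B) j)) =
        even (if i \<in> B \<and> j \<in> J - B then 1 else 0 :: nat)"
      by (simp only: cell_dim_DT[OF AB(1)] cell_dim_DT[OF AB(2)]) simp
  qed
  moreover have "inversions B (J - B) = (\<Sum>i\<in>{1..m}. \<Sum>j\<in>{1..<i}. if i \<in> B \<and> j \<in> J - B then 1 else 0)"
    using assms(3) J by (intro inversions_as_sum) auto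
  ultimately show ?thesis
    by (simp add: pcell_mult_coeff_def)
qed

text \<open>In each factor of the product cell, one of the two cells multiplied has to be the unit \<open>CPt\<close>.\<close>
lemma pcell_mult_coeff_nonzero:
  assumes "pcell_mult_coeff m (DT m A B) (DT m A' B') (DT m I J) \<noteq> (0 :: 'k::field)"
    and AB: "basis_index m K A B" and A'B': "basis_index m K A' B'" and IJ: "basis_index m K I J"
  shows "A \<subseteq> I \<and> B \<subseteq> J \<and> A' = I - A \<and> B' = J - B"
proof -
  have mult: "cell_mult (DT m A B i) (DT m A' B' i) = Some (DT m I J i)" if "i \<in> {1..m}" for i
    using assms(1) that unfolding pcell_mult_coeff_def by (meson)
  have "(i \<in> A \<longrightarrow> i \<in> I) \<and> (i \<in> B \<longrightarrow> i \<in> J) \<and> (i \<in> A' \<longleftrightarrow> i \<in> I \<and> i \<notin> A) \<and> (i \<in> B' \<longleftrightarrow> i \<in> J \<and> i \<notin> B)" for i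
  proof (cases "i \<in> {1..m}")
    case True
    have "\<not> (i \<in> A \<and> i \<in> B)" "\<not> (i \<in> A' \<and> i \<in> B')" "\<not> (i \<in> I \<and> i \<in> J)"
      using AB A'B' IJ by (auto simp: basis_index_def)
    then show ?thesis
      using mult[OF True] unfolding DT_apply[OF True] by (auto split: if_splits)
  next
    case False
    then show ?thesis
      using basis_index_vertices[OF complex AB] basis_index_vertices[OF complex A'B']
        basis_index_vertices[OF complex IJ] by blast
  qed
  then show ?thesis by blast
qed

text \<open>Of the pairs of cells over which the product sums, only those remain that split \<open>I\<close> and \<open>J\<close>
  between the two factors.\<close>
lemma CZK_coord_product:
  assumes IJ: "basis_index m K I J"
  shows "(\<Sum>x\<in>ZK_cells m K. \<Sum>y\<in>ZK_cells m K. pcell_mult_coeff m x y (DT m I J) * (a x * b y)) =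
    (monomial_mult (CZK_coord a) (CZK_coord b) I J :: 'k::field)"
proof -
  let ?C = "ZK_cells m K"
  let ?h = "\<lambda>(A, B). (DT m A B, DT m (I - A) (J - B))"
  let ?g = "\<lambda>(x, y). pcell_mult_coeff m x y (DT m I J) * (a x * b y)"
  have idx: "basis_index m K A B" "basis_index m K (I - A) (J - B)" if "A \<subseteq> I" "B \<subseteq> J" for A B
    using that by (auto intro: basis_index_subset[OF complex IJ])
  have inj: "inj_on ?h (Pow I \<times> Pow J)"
    by (rule inj_onI) (auto simp: DT_inject[OF idx(1) idx(1)])
  have "(\<Sum>x\<in>?C. \<Sum>y\<in>?C. pcell_mult_coeff m x y (DT m I J) * (a x * b y)) = sum ?g (?C \<times> ?C)"
    by (rule sum.cartesian_product)
  also have "\<dots> = sum ?g (?h ` (Pow I \<times> Pow J))"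
  proof (rule sum.mono_neutral_right)
    show "finite (?C \<times> ?C)" using finite_cells by simp
    show "?h ` (Pow I \<times> Pow J) \<subseteq> ?C \<times> ?C" using DT_in_cells idx by auto
    show "\<forall>p\<in>?C \<times> ?C - ?h ` (Pow I \<times> Pow J). ?g p = 0"
    proof (rule ballI, rule ccontr)
      fix p assume p: "p \<in> ?C \<times> ?C - ?h ` (Pow I \<times> Pow J)" and "?g p \<noteq> 0"
      then obtain x y where x: "x \<in> ?C" and y: "y \<in> ?C" and notin: "(x, y) \<notin> ?h ` (Pow I \<times> Pow J)"
        and nz: "pcell_mult_coeff m x y (DT m I J) \<noteq> (0::'k)"
        by (cases p) auto
      obtain A B where AB: "basis_index m K A B" "x = DT m A B" using x by (rule ZK_cells_cases)
      obtain A' B' where A'B': "basis_index m K A' B'" "y = DT m A' B'" using y by (rule ZK_cells_cases)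
      have "A \<subseteq> I \<and> B \<subseteq> J \<and> A' = I - A \<and> B' = J - B"
        using nz AB A'B' IJ by (intro pcell_mult_coeff_nonzero[where 'k = 'k]) auto
      then have "(x, y) \<in> ?h ` (Pow I \<times> Pow J)"
        using AB A'B' by (intro image_eqI[of _ _ "(A, B)"]) auto
      with notin show False by contradiction
    qed
  qed
  also have "\<dots> = (\<Sum>(A, B)\<in>Pow I \<times> Pow J. (-1) ^ inversions B (J - B) *
      (CZK_coord a A B * CZK_coord b (I - A) (J - B)))"
    unfolding sum.reindex[OF inj]
    by (intro sum.cong refl) (auto simp: pcell_mult_coeff_split[OF IJ] CZK_coord_def)
  also have "\<dots> = monomial_mult (CZK_coord a) (CZK_coord b) I J"
    unfolding monomial_mult_def by (rule sum.cartesian_product[symmetric])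
  finally show ?thesis .
qed

lemma pcell_dim_DT:
  assumes "basis_index m K I J"
  shows "pcell_dim m (DT m I J) = 2 * card I + card J"
proof -
  have "pcell_dim m (DT m I J) = (\<Sum>i\<in>{1..m}. 2 * (if i \<in> I then 1 else 0) + (if i \<in> J then 1 else 0))"
    unfolding pcell_dim_def by (intro sum.cong refl cell_dim_DT[OF assms])
  also have "\<dots> = 2 * card ({1..m} \<inter> I) + card ({1..m} \<inter> J)"
    by (simp add: sum.distrib sum.If_cases flip: sum_distrib_left)
  also have "{1..m} \<inter> I = I" using basis_index_vertices[OF complex assms] by blast
  also have "{1..m} \<inter> J = J" using basis_index_vertices[OF complex assms] by blast
  finally show ?thesis .
qed

lemma CZK_simps:
  "carrier (CZK m K) = (ZK_cells m K \<rightarrow>\<^sub>E UNIV)"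
  "x \<otimes>\<^bsub>CZK m K\<^esub> y = (\<lambda>c\<in>ZK_cells m K. \<Sum>u\<in>ZK_cells m K. \<Sum>v\<in>ZK_cells m K.
     pcell_mult_coeff m u v c * (x u * y v))"
  "\<one>\<^bsub>CZK m K\<^esub> = cell_dual m K (DT m {} {})"
  "\<zero>\<^bsub>CZK m K\<^esub> = (\<lambda>c\<in>ZK_cells m K. 0)"
  "x \<oplus>\<^bsub>CZK m K\<^esub> y = (\<lambda>c\<in>ZK_cells m K. x c + y c)"
  "k \<odot>\<^bsub>CZK m K\<^esub> x = (\<lambda>c\<in>ZK_cells m K. k * x c)"
  "graded (CZK m K) n = {a \<in> ZK_cells m K \<rightarrow>\<^sub>E UNIV. \<forall>c\<in>ZK_cells m K. a c \<noteq> 0 \<longrightarrow> pcell_dim m c = n}"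
  "diff (CZK m K) x = (\<lambda>c\<in>ZK_cells m K. pairing x (pcell_boundary m c))"
  by (simp_all add: CZK_def Let_def)

lemma CZK_coord_dual:
  assumes "basis_index m K A B" "basis_index m K I J"
  shows "CZK_coord (cell_dual m K (DT m A B)) I J = (if I = A \<and> J = B then 1 else 0 :: 'k::field)"
  using assms by (simp add: CZK_coord_def cell_dual_def DT_in_cells DT_inject)

theorem CZK_coordinates: "dga_coordinates m K (CZK m K :: ('k::field, pcell \<Rightarrow> 'k) dga) CZK_coord"
proof (unfold_locales, unfold CZK_simps)
  have empty: "basis_index m K {} {}" by (simp add: basis_index_def empty_simplex)
  show "simplicial_complex_on m K" by (rule complex)
  fix x y :: "pcell \<Rightarrow> 'k" and c :: 'k and I J
  show "x = y" if xy: "x \<in> ZK_cells m K \<rightarrow>\<^sub>E UNIV" "y \<in> ZK_cells m K \<rightarrow>\<^sub>E UNIV"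
    and eq: "\<And>I J. basis_index m K I J \<Longrightarrow> CZK_coord x I J = CZK_coord y I J"
  proof (rule PiE_ext[OF xy])
    fix c assume "c \<in> ZK_cells m K"
    then show "x c = y c" using eq by (elim ZK_cells_cases) (simp add: CZK_coord_def)
  qed
  show "\<exists>x\<in>ZK_cells m K \<rightarrow>\<^sub>E UNIV. \<forall>I J. basis_index m K I J \<longrightarrow> CZK_coord x I J = f I J"
    for f :: "nat set \<Rightarrow> nat set \<Rightarrow> 'k"
  proof (rule bexI, intro allI impI)
    fix I J assume IJ: "basis_index m K I J"
    show "CZK_coord (\<lambda>c\<in>ZK_cells m K. f {i \<in> {1..m}. c i = CD} {i \<in> {1..m}. c i = CT}) I J = f I J"
      unfolding CZK_coord_def restrict_apply'[OF DT_in_cells[OF IJ]] DT_sets[OF IJ] ..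
  qed simp
  show "{a \<in> ZK_cells m K \<rightarrow>\<^sub>E UNIV. \<forall>c\<in>ZK_cells m K. a c \<noteq> 0 \<longrightarrow> pcell_dim m c = n} =
      {x \<in> ZK_cells m K \<rightarrow>\<^sub>E UNIV. \<forall>I J. basis_index m K I J \<and> CZK_coord x I J \<noteq> (0::'k) \<longrightarrow> 2 * card I + card J = n}"
    for n
  proof -
    have "(\<forall>c\<in>ZK_cells m K. a c \<noteq> 0 \<longrightarrow> pcell_dim m c = n) \<longleftrightarrow>
        (\<forall>I J. basis_index m K I J \<and> CZK_coord a I J \<noteq> 0 \<longrightarrow> 2 * card I + card J = n)" for a :: "pcell \<Rightarrow> 'k"
      unfolding CZK_coord_def by (metis DT_in_cells ZK_cells_cases pcell_dim_DT)
    then show ?thesis by simp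
  qed
  assume IJ: "basis_index m K I J"
  note cell = DT_in_cells[OF IJ]
  show "CZK_coord (cell_dual m K (DT m {} {})) I J = (monomial_one I J :: 'k)"
    using CZK_coord_dual[OF empty IJ] by (simp add: monomial_one_def)
  show "CZK_coord (\<lambda>c\<in>ZK_cells m K. \<Sum>u\<in>ZK_cells m K. \<Sum>v\<in>ZK_cells m K.
      pcell_mult_coeff m u v c * (x u * y v)) I J = monomial_mult (CZK_coord x) (CZK_coord y) I J"
    using CZK_coord_product[OF IJ] cell by (simp add: CZK_coord_def[of "restrict _ _"])
  show "CZK_coord (\<lambda>c\<in>ZK_cells m K. pairing x (pcell_boundary m c)) I J = monomial_diff (CZK_coord x) I J"
    using CZK_coord_coboundary[OF IJ] cell by (simp add: CZK_coord_def[of "restrict _ _"])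
qed (auto simp: CZK_coord_def DT_in_cells cell_dual_def)

lemma cell_dual_in_CZK: "cell_dual m K c \<in> carrier (CZK m K)"
  by (simp add: CZK_simps cell_dual_def)

end


section \<open>The isomorphism\<close>

theorem theorem4p5:
  fixes m :: nat and K :: "nat set set"
  assumes "simplicial_complex_on m K" and "K \<noteq> Pow {1..m}"
  shows "dg_algebra scalars (CK m K :: ('k::field, nat set \<Rightarrow> 'k mpoly set) dga) \<and>
    dg_algebra scalars (CZK m K :: ('k, pcell \<Rightarrow> 'k) dga) \<and>
    (\<exists>\<phi> \<in> dga_iso scalars (CK m K :: ('k, nat set \<Rightarrow> 'k mpoly set) dga) (CZK m K).
       \<forall>I J. I \<in> K \<and> J \<subseteq> {1..m} \<and> I \<inter> J = {} \<longrightarrow>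
         \<phi> (vu m K I J) = cell_dual m K (DT m I J))"
proof -
  interpret simplicial_complex m K by standard (rule assms(1))
  interpret A: dga_coordinates m K "CK m K :: ('k, nat set \<Rightarrow> 'k mpoly set) dga" CK_coord
    by (rule CK_coordinates)
  interpret B: dga_coordinates m K "CZK m K :: ('k, pcell \<Rightarrow> 'k) dga" CZK_coord
    by (rule CZK_coordinates)
  obtain \<phi> where \<phi>: "\<phi> \<in> dga_iso scalars (CK m K :: ('k, nat set \<Rightarrow> 'k mpoly set) dga) (CZK m K)"
    and coord: "\<And>x I J. x \<in> carrier (CK m K) \<Longrightarrow> basis_index m K I J \<Longrightarrow> CZK_coord (\<phi> x) I J = CK_coord x I J"
    using dga_iso_of_coordinates[OF CK_coordinates CZK_coordinates] by blast
  have "\<phi> (vu m K A B) = cell_dual m K (DT m A B)" if AB: "basis_index m K A B" for A B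
  proof (rule B.coord_eqI)
    show "\<phi> (vu m K A B) \<in> carrier (CZK m K)"
      using \<phi> vu_in_CK[OF AB] unfolding dga_iso_def by (blast dest: ring_iso_memE(1))
    fix I J assume IJ: "basis_index m K I J"
    show "CZK_coord (\<phi> (vu m K A B)) I J = CZK_coord (cell_dual m K (DT m A B)) I J"
      by (simp only: coord[OF vu_in_CK[OF AB] IJ] CK_coord_vu[OF AB IJ] CZK_coord_dual[OF AB IJ])
  qed (rule cell_dual_in_CZK)
  then show ?thesis
    using A.dg_algebra B.dg_algebra \<phi> by (auto simp: basis_index_def)
qed

end
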